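(* Let $k$ be a field, $A = k[x_1,\ldots,x_n]$, and let $R = A/I$ be a monomial ring with a minimal Taylor resolution such that each $m \in G(I)$ is a quadratic monomial (i.e. of degree $2$). Then $R$ is a $k$-tensor product of a complete intersection and trivially Golod rings; that is, $R \cong C \otimes_k R_1 \otimes_k \cdots \otimes_k R_s$ as $k$-algebras for some $s \ge 0$, where $C$ is a monomial ring over $k$ that is a complete intersection (possibly $C = k$) and each $R_i$ is a trivially Golod monomial ring over $k$.
   Context: A monomial ring over $k$ is a quotient $A/I$ of a polynomial ring $A$ in finitely many variables over $k$ by a monomial ideal $I$; $G(I) = \{m_1,\ldots,m_t\}$ is the unique minimal set of monomial generators of $I$. The monomial ring $A/I$ is called trivially Golod if the elements of $G(I)$ have a common factor $\neq 1$. It is a complete intersection if $I$ is generated by a regular sequence. The Taylor resolution of $R = A/I$ is the exterior algebra of a free $A$-module of rank $t$, with basis $e_{i_1,\ldots,i_l}$ ($1\le i_1<\cdots<i_l\le t$) and differential $d(e_{i_1,\ldots,i_l}) = \sum_{j=1}^l (-1)^{j-1}\frac{m_{i_1,\ldots,i_l}}{m_{i_1,\ldots,\hat{i}_j,\ldots,i_l}} e_{i_1,\ldots,\hat{i}_j,\ldots,i_l}$, where $m_{i_1,\ldots,i_l} = \operatorname{lcm}(m_{i_1},\ldots,m_{i_l})$. It is minimal if and only if $m_{i_1,\ldots,i_l} \ne m_{i_1,\ldots,\hat{i}_j,\ldots,i_l}$ for all $i_1<\cdots<i_l$ and all $j$; equivalently, for each $i$ there is a variable whose exponent in $m_i$ is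 strictly larger than its exponent in every $m_j$ with $j \ne i$. *)

theory Defs
  imports "HOL-Library.Poly_Mapping" "HOL-Algebra.Algebra"
begin

section \<open>Polynomial rings and monomials\<close>

text \<open>A commutative algebra over \<open>'k\<close> is represented by a \<^type>\<open>module\<close> record of HOL-Algebra, i.e. a
  ring with carrier together with a scalar multiplication by elements of \<open>'k\<close>.
  A monomial is given by its exponent vector, and the elements of \<open>'k poly\<close> are the polynomials in
  countably many variables indexed by \<^typ>\<open>nat\<close>.\<close>

type_synonym mon = "nat \<Rightarrow>\<^sub>0 nat"
type_synonym 'k poly = "mon \<Rightarrow>\<^sub>0 'k"

definition mons :: "nat \<Rightarrow> mon set" where
  "mons n = {e. Poly_Mapping.keys e \<subseteq> {1..n}}"

definition mon_deg :: "mon \<Rightarrow> nat" where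
  "mon_deg e = (\<Sum>v\<in>Poly_Mapping.keys e. Poly_Mapping.lookup e v)"

definition mon_poly :: "mon \<Rightarrow> 'k::comm_ring_1 poly" where
  "mon_poly e = Poly_Mapping.single e 1"

text \<open>The \<open>'k\<close>-algebra \<open>'k[x\<^sub>1, \<dots>, x\<^sub>n]\<close>.\<close>

definition poly_alg :: "nat \<Rightarrow> ('k::comm_ring_1, 'k poly) module" where
  "poly_alg n =
    \<lparr>carrier = {p. Poly_Mapping.keys p \<subseteq> mons n},
     monoid.mult = (*), one = 1, ring.zero = 0, add = (+),
     smult = (\<lambda>c p. Poly_Mapping.single 0 c * p)\<rparr>"

section \<open>Monomial rings\<close>

definition quot_alg :: "('k, 'a) module \<Rightarrow> 'a set \<Rightarrow> ('k, 'a set) module" where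
  "quot_alg M I = ring.extend (M Quot I)
    (module.fields (\<lambda>c Y. \<Union>y\<in>Y. I +>\<^bsub>M\<^esub> (c \<odot>\<^bsub>M\<^esub> y)))"

definition monomial_ideal :: "nat \<Rightarrow> 'k::field poly set \<Rightarrow> bool" where
  "monomial_ideal n I \<longleftrightarrow> (\<exists>E\<subseteq>mons n. I = Idl\<^bsub>poly_alg n\<^esub> (mon_poly ` E))"

abbreviation monomial_ring :: "nat \<Rightarrow> 'k::field poly set \<Rightarrow> ('k, 'k poly set) module" where
  "monomial_ring n I \<equiv> quot_alg (poly_alg n) I"

text \<open>\<open>G(I)\<close>, as a set of exponent vectors.\<close>

definition min_gens :: "nat \<Rightarrow> 'k::field poly set \<Rightarrow> mon set" where
  "min_gens n I = (THE E. E \<subseteq> mons n \<and> Idl\<^bsub>poly_alg n\<^esub> (mon_poly ` E) = I \<and>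
     (\<forall>F. F \<subset> E \<longrightarrow> Idl\<^bsub>poly_alg n\<^esub> ((mon_poly :: mon \<Rightarrow> 'k poly) ` F) \<noteq> I))"

definition trivially_golod :: "nat \<Rightarrow> 'k::field poly set \<Rightarrow> bool" where
  "trivially_golod n I \<longleftrightarrow>
    (\<exists>d\<in>mons n. mon_poly d \<noteq> (1 :: 'k poly) \<and>
      (\<forall>e\<in>min_gens n I. (mon_poly d :: 'k poly) divides\<^bsub>poly_alg n\<^esub> mon_poly e))"

text \<open>The \<open>i\<close>-th element is a non-zero-divisor modulo the ideal of the previous ones, and the last
  quotient is nonzero.\<close>

definition regular_sequence :: "('a, 'b) ring_scheme \<Rightarrow> 'a list \<Rightarrow> bool" where
  "regular_sequence A fs \<longleftrightarrow> set fs \<subseteq> carrier A \<and>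
    (\<forall>i<length fs. \<forall>a\<in>carrier A.
      fs ! i \<otimes>\<^bsub>A\<^esub> a \<in> Idl\<^bsub>A\<^esub> (set (take i fs)) \<longrightarrow> a \<in> Idl\<^bsub>A\<^esub> (set (take i fs))) \<and>
    Idl\<^bsub>A\<^esub> (set fs) \<noteq> carrier A"

definition complete_intersection :: "nat \<Rightarrow> 'k::field poly set \<Rightarrow> bool" where
  "complete_intersection n I \<longleftrightarrow>
    (\<exists>fs. regular_sequence (poly_alg n) fs \<and> I = Idl\<^bsub>poly_alg n\<^esub> (set fs))"

section \<open>The Taylor resolution\<close>

definition mon_lcm :: "(nat \<Rightarrow> mon) \<Rightarrow> nat set \<Rightarrow> mon" where
  "mon_lcm m S = Abs_poly_mapping (\<lambda>v. Max (insert 0 ((\<lambda>i. Poly_Mapping.lookup (m i) v) ` S)))"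

text \<open>The basis element \<open>e\<close> with indices \<open>i\<^sub>1 < \<dots> < i\<^sub>l\<close> is represented by \<open>S = {i\<^sub>1, \<dots>, i\<^sub>l}\<close>, and an
  element of the free module by its coefficients. If \<open>i\<close> is the \<open>j\<close>-th element of \<open>S\<close>, then
  \<open>j - 1\<close> is the number of elements of \<open>S\<close> below \<open>i\<close>. Quotients of monomials are differences of
  exponent vectors.\<close>

definition taylor_module :: "nat \<Rightarrow> nat \<Rightarrow> (nat set \<Rightarrow>\<^sub>0 'k::field poly) set" where
  "taylor_module n t =
    {f. Poly_Mapping.keys f \<subseteq> Pow {1..t} \<and> (\<forall>S. Poly_Mapping.lookup f S \<in> carrier (poly_alg n))}"

definition taylor_diff ::
  "(nat \<Rightarrow> mon) \<Rightarrow> (nat set \<Rightarrow>\<^sub>0 'k::field poly) \<Rightarrow> (nat set \<Rightarrow>\<^sub>0 'k poly)" where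
  "taylor_diff m f =
    (\<Sum>S\<in>Poly_Mapping.keys f. \<Sum>i\<in>S.
       Poly_Mapping.single (S - {i})
         (Poly_Mapping.lookup f S *
           ((-1) ^ card {j\<in>S. j < i} * mon_poly (mon_lcm m S - mon_lcm m (S - {i})))))"

text \<open>Minimality of the resolution \<open>F\<close>: \<open>d(F) \<subseteq> \<mm>F\<close> for \<open>\<mm> = (x\<^sub>1, \<dots>, x\<^sub>n)\<close>.\<close>

definition taylor_minimal :: "'k::field itself \<Rightarrow> nat \<Rightarrow> nat \<Rightarrow> (nat \<Rightarrow> mon) \<Rightarrow> bool" where
  "taylor_minimal _ n t m \<longleftrightarrow>
    (\<forall>f\<in>taylor_module n t. \<forall>S.
      Poly_Mapping.lookup (taylor_diff m f) S \<in>
        Idl\<^bsub>poly_alg n\<^esub> ((\<lambda>v. mon_poly (Poly_Mapping.single v 1) :: 'k poly) ` {1..n}))"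

section \<open>Tensor products and isomorphisms of algebras\<close>

text \<open>The tensor product over \<open>'k\<close> of a finite family \<open>(R i)\<close>, \<open>i \<in> S\<close>, of commutative algebras is
  the free \<open>'k\<close>-module on the product of the carriers, with the multiplication that extends the
  componentwise one bilinearly, modulo the relations expressing multilinearity.
  The product of a relation with a basis element is again a relation, so the ideal generated by
  the relations is their \<open>'k\<close>-linear span.\<close>

definition tensor_free ::
  "'i set \<Rightarrow> ('i \<Rightarrow> ('k::comm_ring_1, 'a) module) \<Rightarrow> ('k, ('i \<Rightarrow> 'a) \<Rightarrow>\<^sub>0 'k) module" where
  "tensor_free S R =
    \<lparr>carrier = {f. Poly_Mapping.keys f \<subseteq> (\<Pi>\<^sub>E i\<in>S. carrier (R i))},
     monoid.mult = (\<lambda>f g. \<Sum>u\<in>Poly_Mapping.keys f. \<Sum>v\<in>Poly_Mapping.keys g.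
       Poly_Mapping.single (\<lambda>i\<in>S. u i \<otimes>\<^bsub>R i\<^esub> v i)
         (Poly_Mapping.lookup f u * Poly_Mapping.lookup g v)),
     one = Poly_Mapping.single (\<lambda>i\<in>S. \<one>\<^bsub>R i\<^esub>) 1,
     ring.zero = 0,
     add = (+),
     smult = (\<lambda>c. Poly_Mapping.map ((*) c))\<rparr>"

definition tensor_relations ::
  "'i set \<Rightarrow> ('i \<Rightarrow> ('k::comm_ring_1, 'a) module) \<Rightarrow> (('i \<Rightarrow> 'a) \<Rightarrow>\<^sub>0 'k) set" where
  "tensor_relations S R =
    {Poly_Mapping.single (u(i := a \<oplus>\<^bsub>R i\<^esub> b)) 1
       - Poly_Mapping.single (u(i := a)) 1 - Poly_Mapping.single (u(i := b)) 1 | u i a b.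
       u \<in> (\<Pi>\<^sub>E i\<in>S. carrier (R i)) \<and> i \<in> S \<and> a \<in> carrier (R i) \<and> b \<in> carrier (R i)} \<union>
    {Poly_Mapping.single (u(i := c \<odot>\<^bsub>R i\<^esub> a)) 1 - Poly_Mapping.single (u(i := a)) c | u i a c.
       u \<in> (\<Pi>\<^sub>E i\<in>S. carrier (R i)) \<and> i \<in> S \<and> a \<in> carrier (R i)}"

definition tensor_alg ::
  "'i set \<Rightarrow> ('i \<Rightarrow> ('k::comm_ring_1, 'a) module) \<Rightarrow> ('k, (('i \<Rightarrow> 'a) \<Rightarrow>\<^sub>0 'k) set) module" where
  "tensor_alg S R = quot_alg (tensor_free S R) (Idl\<^bsub>tensor_free S R\<^esub> (tensor_relations S R))"

definition alg_isomorphic :: "('k, 'a) module \<Rightarrow> ('k, 'b) module \<Rightarrow> bool" where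
  "alg_isomorphic R R' \<longleftrightarrow>
    (\<exists>h\<in>ring_iso R R'. \<forall>c. \<forall>x\<in>carrier R. h (c \<odot>\<^bsub>R\<^esub> x) = c \<odot>\<^bsub>R'\<^esub> h x)"

end

theory Submission
  imports Defs
begin

text \<open>
  Minimality of the Taylor resolution gives every generator \<open>m i\<close> a private variable \<open>v\<close>, whose exponent
  in \<open>m i\<close> exceeds its exponent in all other generators (\<open>taylor_minimal_lcm\<close>, \<open>mon_lcm_remove_neq\<close>).
  A quadratic generator is therefore \<open>x\<^sub>v x\<^sub>w\<close> for one further variable \<open>w\<close>, its center, where \<open>w = v\<close>
  for a square. Generators with different centers have no variable in common: a private variable
  \<open>v \<noteq> w\<close> has exponent 1 in its generator and hence exponent 0 in all others, and a generator that is
  the square of its private variable has that variable as center. So the variables fall into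
  disjoint blocks, one for each center \<open>w\<close>, such that every generator lives in the block of its center
  and is divisible by \<open>x\<^sub>w\<close>. Each block carries a trivially Golod ring. The variables that occur in no
  generator carry the complete intersection, which is a polynomial ring.

  It remains to see that \<open>A/I\<close> is the tensor product \<open>T/K\<close> of the rings of the blocks
  (\<open>monomial_ring_splits\<close>), where \<open>T\<close> is the free module on tuples and \<open>K\<close> is generated by the
  multilinearity relations. A monomial \<open>x\<^sup>e\<close> is the product of its components in the blocks and
  lies in \<open>I\<close> iff one component lies in the ideal of its block. Sending \<open>x\<^sup>e\<close> to the tuple of the classes
  of its components defines a ring homomorphism \<open>A \<rightarrow> T/K\<close>. It is onto because tensors expand into
  monomials by multilinearity (\<open>single_mod_K\<close>), and it kills \<open>I\<close> because a tuple with a zero entry is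
  zero (\<open>push_I_in_K\<close>). Its kernel is exactly \<open>I\<close>: multiplying representatives of the entries of a tuple
  gives a map from \<open>T\<close> to \<open>A\<close> that sends \<open>K\<close> into \<open>I\<close> (\<open>evaluate_K\<close>) and undoes the homomorphism modulo
  \<open>I\<close> (\<open>evaluate_push\<close>).\<close>

section \<open>Finitely supported functions as linear combinations\<close>

text \<open>Linear identities are checked on the basis elements in a prescribed set. The set is carried along
because the operations on tensors obey their laws only on the carriers of the factors.\<close>

lemma poly_mapping_supp_induct [consumes 1, case_names zero single add]:
  assumes "Poly_Mapping.keys f \<subseteq> B"
    and zero: "P 0"
    and single: "\<And>u c. u \<in> B \<Longrightarrow> P (Poly_Mapping.single u c)"
    and add: "\<And>f g. Poly_Mapping.keys f \<subseteq> B \<Longrightarrow> Poly_Mapping.keys g \<subseteq> B \<Longrightarrow> P f \<Longrightarrow> P g \<Longrightarrow> P (f + g)"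
  shows "P (f :: 'a \<Rightarrow>\<^sub>0 'b::comm_monoid_add)"
  using assms(1)
proof (induction f rule: update_induct)
  case const
  show ?case by (rule zero)
next
  case (update f a b)
  have eq: "Poly_Mapping.update a b f = Poly_Mapping.single a b + f"
    using update.hyps(1)
    by (intro poly_mapping_eqI) (auto simp: lookup_update lookup_add lookup_single when_def in_keys_iff)
  have "Poly_Mapping.keys (Poly_Mapping.update a b f) = insert a (Poly_Mapping.keys f)"
    using update.hyps by (simp add: keys_update)
  with update.prems have "a \<in> B" "Poly_Mapping.keys f \<subseteq> B" by auto
  with update.IH show ?case unfolding eq by (intro add single) auto
qed

text \<open>Linear extension from a basis. Only additivity of \<open>g u\<close> in the coefficient matters, so that
  one operator covers maps between free modules, evaluation of tensors, the degree of a monomial and,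
  nested, bilinear multiplications.\<close>

definition lin_ext :: "('a \<Rightarrow> 'b::zero \<Rightarrow> 'c::comm_monoid_add) \<Rightarrow> ('a \<Rightarrow>\<^sub>0 'b) \<Rightarrow> 'c" where
  "lin_ext g f = (\<Sum>u\<in>Poly_Mapping.keys f. g u (Poly_Mapping.lookup f u))"

lemma lin_ext_zero [simp]: "lin_ext g 0 = 0"
  by (simp add: lin_ext_def)

lemma lin_ext_single [simp]:
  assumes "g u 0 = 0"
  shows "lin_ext g (Poly_Mapping.single u c) = g u c"
  using assms by (cases "c = 0") (auto simp: lin_ext_def)

lemma lin_ext_add:
  assumes "\<And>u. g u 0 = 0" "\<And>u a b. g u (a + b) = g u a + g u b"
  shows "lin_ext g (f + f') = lin_ext g f + lin_ext g f'"
  unfolding lin_ext_def by (rule setsum_keys_plus_distrib) (auto simp: assms)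

lemma lin_ext_diff:
  fixes f f' :: "'a \<Rightarrow>\<^sub>0 'b::ab_group_add" and g :: "'a \<Rightarrow> 'b \<Rightarrow> 'c::ab_group_add"
  assumes "\<And>u. g u 0 = 0" "\<And>u a b. g u (a + b) = g u a + g u b"
  shows "lin_ext g (f - f') = lin_ext g f - lin_ext g f'"
  using lin_ext_add[of g "f - f'" f', OF assms] by (simp add: algebra_simps)

lemma lin_ext_sum:
  "lin_ext (\<lambda>u a. g u a + h u a) f = lin_ext g f + lin_ext h f"
  by (simp add: lin_ext_def sum.distrib)

definition push :: "('a \<Rightarrow> 'b) \<Rightarrow> ('a \<Rightarrow>\<^sub>0 'c) \<Rightarrow> ('b \<Rightarrow>\<^sub>0 'c::comm_monoid_add)" where
  "push w = lin_ext (\<lambda>u. Poly_Mapping.single (w u))"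

lemma push_zero [simp]: "push w 0 = 0"
  and push_single [simp]: "push w (Poly_Mapping.single u c) = Poly_Mapping.single (w u) c"
  and push_add: "push w (p + q) = push w p + push w q"
  by (simp_all add: push_def lin_ext_add single_add)

lemma push_diff: "push w (p - q) = push w p - push w (q :: 'a \<Rightarrow>\<^sub>0 'c::ab_group_add)"
  by (simp add: push_def lin_ext_diff single_add)

lemma keys_push: "Poly_Mapping.keys (push w p) \<subseteq> w ` Poly_Mapping.keys p"
  unfolding push_def lin_ext_def
  by (rule order_trans[OF keys_sum]) (auto split: if_splits)

lemma push_mult:
  fixes p q :: "'a::monoid_add \<Rightarrow>\<^sub>0 'c::semiring_0"
  assumes add: "\<And>a b. w (a + b) = w a + w b"
  shows "push w (p * q) = push w p * push w q"
proof (rule poly_mapping_supp_induct[of p UNIV])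
  fix u :: 'a and c :: 'c
  show "push w (Poly_Mapping.single u c * q) = push w (Poly_Mapping.single u c) * push w q"
    by (rule poly_mapping_supp_induct[of q UNIV])
      (auto simp: mult_single push_add distrib_left add)
qed (auto simp: push_add distrib_right)

lemma keys_diff_subset:
  fixes p q :: "'a \<Rightarrow>\<^sub>0 'b::ab_group_add"
  assumes "Poly_Mapping.keys p \<subseteq> B" "Poly_Mapping.keys q \<subseteq> B"
  shows "Poly_Mapping.keys (p - q) \<subseteq> B"
  using assms by (auto simp: in_keys_iff lookup_minus subset_iff) (metis diff_self)

lemma keys_add_subset:
  fixes p q :: "'a \<Rightarrow>\<^sub>0 'b::comm_monoid_add"
  assumes "Poly_Mapping.keys p \<subseteq> B" "Poly_Mapping.keys q \<subseteq> B"
  shows "Poly_Mapping.keys (p + q) \<subseteq> B"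
  using assms keys_add[of p q] by blast

lemma keys_uminus_eq [simp]:
  fixes p :: "'a \<Rightarrow>\<^sub>0 'b::ab_group_add"
  shows "Poly_Mapping.keys (- p) = Poly_Mapping.keys p"
  by (auto simp: in_keys_iff)

section \<open>Quotient algebras\<close>

lemma quot_alg_simps [simp]:
  "carrier (quot_alg M I) = carrier (M Quot I)"
  "monoid.mult (quot_alg M I) = monoid.mult (M Quot I)"
  "one (quot_alg M I) = one (M Quot I)"
  "ring.zero (quot_alg M I) = ring.zero (M Quot I)"
  "add (quot_alg M I) = add (M Quot I)"
  "smult (quot_alg M I) c Y = (\<Union>y\<in>Y. I +>\<^bsub>M\<^esub> (c \<odot>\<^bsub>M\<^esub> y))"
  by (simp_all add: quot_alg_def ring.defs module.defs)

lemma monoid_quot_alg: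
  assumes "ideal I M" shows "monoid (quot_alg M I)"
proof -
  interpret ring "M Quot I" by (rule ideal.quotient_is_ring[OF assms])
  show ?thesis by (rule monoidI) (simp_all add: m_assoc)
qed

lemma ring_iso_quot_alg: "ring_iso (quot_alg M I) (quot_alg M' I') = ring_iso (M Quot I) (M' Quot I')"
  by (simp add: ring_iso_def ring_hom_def)

text \<open>Polynomials and formal combinations of pure tensors are added by the type class addition.
  For such rings, cosets and congruences modulo an ideal reduce to differences, which are accessible
  to ordinary algebraic simplification.\<close>

lemma a_inv_eq_uminus:
  fixes M :: "('a::ab_group_add, 'b) ring_scheme"
  assumes "ring M" and M: "add M = (+)" "ring.zero M = 0" and x: "x \<in> carrier M"
  shows "a_inv M x = - x"
proof -
  interpret ring M by fact
  show ?thesis using l_neg[OF x] by (simp add: M eq_neg_iff_add_eq_0)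
qed

lemma ideal_class_opsI:
  fixes M :: "('a::ab_group_add, 'b) ring_scheme"
  assumes R: "ring M" and M: "add M = (+)" "ring.zero M = 0"
    and I: "I \<subseteq> carrier M" "0 \<in> I" "\<And>x y. x \<in> I \<Longrightarrow> y \<in> I \<Longrightarrow> x + y \<in> I" "\<And>x. x \<in> I \<Longrightarrow> - x \<in> I"
    and mult: "\<And>a x. a \<in> I \<Longrightarrow> x \<in> carrier M \<Longrightarrow> x \<otimes>\<^bsub>M\<^esub> a \<in> I"
      "\<And>a x. a \<in> I \<Longrightarrow> x \<in> carrier M \<Longrightarrow> a \<otimes>\<^bsub>M\<^esub> x \<in> I"
  shows "ideal I M"
proof (rule idealI[OF R _ mult])
  interpret ring M by fact
  have "inv\<^bsub>add_monoid M\<^esub> x = - x" if "x \<in> I" for x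
    using a_inv_eq_uminus[OF R M, of x] that I(1) by (auto simp: a_inv_def)
  with I(4) have "inv\<^bsub>add_monoid M\<^esub> x \<in> I" if "x \<in> I" for x using that by metis
  then show "subgroup I (add_monoid M)"
    using I by (intro add.subgroupI) (auto simp: M a_inv_def)
qed

lemma
  fixes M :: "('a::ab_group_add, 'b) ring_scheme"
  assumes "ideal I M" and M: "add M = (+)" "ring.zero M = 0"
  shows ideal_zero: "0 \<in> I"
    and ideal_add: "x \<in> I \<Longrightarrow> y \<in> I \<Longrightarrow> x + y \<in> I"
    and ideal_uminus: "x \<in> I \<Longrightarrow> - x \<in> I"
    and ideal_diff: "x \<in> I \<Longrightarrow> y \<in> I \<Longrightarrow> x - y \<in> I"
proof -
  interpret ideal I M by fact
  have ring: "ring M" by (rule ring_axioms)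
  note sub = additive_subgroup.zero_closed[OF is_additive_subgroup]
    additive_subgroup.a_inv_closed[OF is_additive_subgroup] a_closed
    additive_subgroup.a_closed[OF is_additive_subgroup]
  show "0 \<in> I" using sub(1) by (simp add: M)
  show add: "x + y \<in> I" if "x \<in> I" "y \<in> I" for x y using sub(4)[OF that] by (simp add: M)
  show uminus: "- x \<in> I" if "x \<in> I" for x
    using sub(2)[OF that] Icarr[OF that] a_inv_eq_uminus[OF ring M] by simp
  show "x - y \<in> I" if "x \<in> I" "y \<in> I" for x y
    using add[OF that(1) uminus[OF that(2)]] by simp
qed

lemma coset_mem_iff:
  fixes M :: "('a::ab_group_add, 'b) ring_scheme"
  assumes "add M = (+)"
  shows "x \<in> I +>\<^bsub>M\<^esub> p \<longleftrightarrow> x - p \<in> I"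
proof -
  have "x \<in> I +>\<^bsub>M\<^esub> p \<longleftrightarrow> (\<exists>h\<in>I. x = h + p)" by (auto simp: a_r_coset_def' assms)
  also have "\<dots> \<longleftrightarrow> x - p \<in> I" by (metis add_diff_cancel diff_add_cancel)
  finally show ?thesis .
qed

lemma coset_eq_iff:
  fixes M :: "('a::ab_group_add, 'b) ring_scheme"
  assumes I: "ideal I M" and M: "add M = (+)" "ring.zero M = 0"
  shows "I +>\<^bsub>M\<^esub> p = I +>\<^bsub>M\<^esub> q \<longleftrightarrow> p - q \<in> I"
proof
  assume "I +>\<^bsub>M\<^esub> p = I +>\<^bsub>M\<^esub> q"
  moreover have "p \<in> I +>\<^bsub>M\<^esub> p" using ideal_zero[OF I M] by (simp add: coset_mem_iff M)
  ultimately show "p - q \<in> I" by (simp add: coset_mem_iff M)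
next
  assume pq: "p - q \<in> I"
  have "x - p \<in> I \<longleftrightarrow> x - q \<in> I" for x
    using ideal_add[OF I M _ pq, of "x - p"] ideal_diff[OF I M _ pq, of "x - q"] by auto
  then show "I +>\<^bsub>M\<^esub> p = I +>\<^bsub>M\<^esub> q" by (auto simp: coset_mem_iff M)
qed

text \<open>The union in the scalar multiplication of a quotient collapses to a single coset when the
  scalar acts as multiplication by a ring element, because an ideal absorbs ring elements.\<close>

lemma quot_alg_smult:
  fixes M :: "('k, 'a::ab_group_add) module"
  assumes I: "ideal I M" and M: "add M = (+)" "ring.zero M = 0"
    and s: "s \<in> carrier M" "\<And>x. x \<in> carrier M \<Longrightarrow> c \<odot>\<^bsub>M\<^esub> x = s \<otimes>\<^bsub>M\<^esub> x"
    and p: "p \<in> carrier M"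
  shows "c \<odot>\<^bsub>quot_alg M I\<^esub> (I +>\<^bsub>M\<^esub> p) = I +>\<^bsub>M\<^esub> (c \<odot>\<^bsub>M\<^esub> p)"
proof -
  interpret ideal I M by fact
  have "I +>\<^bsub>M\<^esub> (c \<odot>\<^bsub>M\<^esub> y) = I +>\<^bsub>M\<^esub> (c \<odot>\<^bsub>M\<^esub> p)" if y: "y \<in> I +>\<^bsub>M\<^esub> p" for y
  proof -
    from y have yp: "y - p \<in> I" by (simp add: coset_mem_iff M)
    then have "y - p \<in> carrier M" by (rule Icarr)
    then have "s \<otimes>\<^bsub>M\<^esub> ((y - p) \<oplus>\<^bsub>M\<^esub> p) = s \<otimes>\<^bsub>M\<^esub> (y - p) \<oplus>\<^bsub>M\<^esub> s \<otimes>\<^bsub>M\<^esub> p"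
      using s(1) p by (intro r_distr)
    moreover have "y \<in> carrier M" using a_closed[OF \<open>y - p \<in> carrier M\<close> p] by (simp add: M)
    ultimately have "c \<odot>\<^bsub>M\<^esub> y - c \<odot>\<^bsub>M\<^esub> p = s \<otimes>\<^bsub>M\<^esub> (y - p)" using p by (simp add: M s(2))
    with I_l_closed[OF yp s(1)] show ?thesis by (simp add: coset_eq_iff[OF I M])
  qed
  moreover have "p \<in> I +>\<^bsub>M\<^esub> p" using ideal_zero[OF I M] by (simp add: coset_mem_iff M)
  ultimately show ?thesis unfolding quot_alg_simps by blast
qed

section \<open>Polynomial rings and monomial ideals\<close>

lemma zero_mons [simp]: "0 \<in> mons n"
  by (simp add: mons_def)

lemma mons_add [simp]: "a \<in> mons n \<Longrightarrow> b \<in> mons n \<Longrightarrow> a + b \<in> mons n"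
  by (simp add: mons_def keys_add_subset)

lemma mons_addD: "a + b \<in> mons n \<Longrightarrow> a \<in> mons n \<and> b \<in> mons n"
  by (auto simp: mons_def in_keys_iff lookup_add subset_iff)

lemma mons_sum: "(\<And>i. i \<in> S \<Longrightarrow> f i \<in> mons n) \<Longrightarrow> sum f S \<in> mons n"
  by (induction S rule: infinite_finite_induct) auto

lemma poly_alg_simps [simp]:
  "carrier (poly_alg n) = {p. Poly_Mapping.keys p \<subseteq> mons n}"
  "monoid.mult (poly_alg n) = (*)" "one (poly_alg n) = 1"
  "ring.zero (poly_alg n) = 0" "add (poly_alg n) = (+)"
  "smult (poly_alg n) c p = Poly_Mapping.single 0 c * p"
  by (simp_all add: poly_alg_def)

lemma keys_mult_mons:
  "Poly_Mapping.keys p \<subseteq> mons n \<Longrightarrow> Poly_Mapping.keys q \<subseteq> mons n \<Longrightarrow> Poly_Mapping.keys (p * q) \<subseteq> mons n"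
  using keys_mult[of p q] by (blast intro: mons_add)

lemma cring_poly_alg: "cring (poly_alg n :: ('k::comm_ring_1, 'k poly) module)"
proof (rule cringI)
  show "abelian_group (poly_alg n :: ('k, 'k poly) module)"
  proof (rule abelian_groupI)
    fix x :: "'k poly" assume "x \<in> carrier (poly_alg n)"
    then show "\<exists>y\<in>carrier (poly_alg n). y \<oplus>\<^bsub>poly_alg n\<^esub> x = \<zero>\<^bsub>poly_alg n\<^esub>"
      by (intro bexI[of _ "- x"]) auto
  qed (simp_all add: add_ac keys_add_subset)
  show "comm_monoid (poly_alg n :: ('k, 'k poly) module)"
    by (rule comm_monoidI) (simp_all add: mult_ac keys_mult_mons)
qed (auto simp: algebra_simps)

lemma ring_poly_alg: "ring (poly_alg n :: ('k::comm_ring_1, 'k poly) module)"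
  by (rule cring.axioms(1)[OF cring_poly_alg])

text \<open>The exponent vectors of the monomials in the ideal generated by \<open>E\<close>.\<close>

definition multiples :: "nat \<Rightarrow> mon set \<Rightarrow> mon set" where
  "multiples n E = {e \<in> mons n. \<exists>d\<in>E. \<exists>a. e = d + a}"

lemma multiples_add: "e \<in> multiples n E \<Longrightarrow> a \<in> mons n \<Longrightarrow> e + a \<in> multiples n E"
  unfolding multiples_def using add.assoc[of _ _ a] by fastforce

lemma multiples_self: "E \<subseteq> mons n \<Longrightarrow> e \<in> E \<Longrightarrow> e \<in> multiples n E"
  unfolding multiples_def using add_0_right[of e, symmetric] by blast

lemma keys_subset_ideal:
  assumes U: "U \<subseteq> mons n" "\<And>e a. e \<in> U \<Longrightarrow> a \<in> mons n \<Longrightarrow> e + a \<in> U"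
  shows "ideal {p :: 'k::comm_ring_1 poly. Poly_Mapping.keys p \<subseteq> U} (poly_alg n)"
proof (rule ideal_class_opsI[OF ring_poly_alg])
  let ?I = "{p :: 'k poly. Poly_Mapping.keys p \<subseteq> U}"
  fix a x :: "'k poly" assume a: "a \<in> ?I" "x \<in> carrier (poly_alg n)"
  have "i + j \<in> U" if "i \<in> Poly_Mapping.keys a" "j \<in> Poly_Mapping.keys x" for i j
    using that a U(2) by auto
  with keys_mult[of a x] show ax: "a \<otimes>\<^bsub>poly_alg n\<^esub> x \<in> ?I" by auto
  then show "x \<otimes>\<^bsub>poly_alg n\<^esub> a \<in> ?I" by (simp add: mult.commute)
qed (use U(1) in \<open>auto simp: keys_add_subset\<close>)

text \<open>A monomial ideal is spanned by the monomials that it contains. All questions about monomial ideals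
thereby become questions about sets of exponent vectors.\<close>

lemma Idl_monomials:
  assumes E: "E \<subseteq> mons n"
  shows "Idl\<^bsub>poly_alg n\<^esub> ((mon_poly :: mon \<Rightarrow> 'k::field poly) ` E) =
    {p. Poly_Mapping.keys p \<subseteq> multiples n E}" (is "?L = ?R")
proof
  interpret cring "poly_alg n :: ('k, 'k poly) module" by (rule cring_poly_alg)
  have sub: "(mon_poly :: mon \<Rightarrow> 'k poly) ` E \<subseteq> carrier (poly_alg n)"
    using E by (auto simp: mon_poly_def)
  have "mon_poly ` E \<subseteq> ?R"
    using multiples_self[OF E] by (auto simp: mon_poly_def)
  moreover have "ideal ?R (poly_alg n)"
    by (rule keys_subset_ideal) (auto simp: multiples_add, auto simp: multiples_def)
  ultimately show "?L \<subseteq> ?R" by (intro genideal_minimal)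
  interpret L: ideal ?L "poly_alg n" by (rule genideal_ideal[OF sub])
  show "?R \<subseteq> ?L"
  proof
    fix p :: "'k poly" assume "p \<in> ?R"
    then have "Poly_Mapping.keys p \<subseteq> multiples n E" by simp
    then show "p \<in> ?L"
    proof (induction p rule: poly_mapping_supp_induct)
      case zero
      then show ?case using L.zero_closed by simp
    next
      case (single u c)
      then obtain d a where u: "u = d + a" "d \<in> E" "u \<in> mons n" by (auto simp: multiples_def)
      then have "a \<in> mons n" using mons_addD by blast
      then have "Poly_Mapping.single a c \<in> carrier (poly_alg n)" by simp
      moreover have "(mon_poly d :: 'k poly) \<in> ?L" using genideal_self[OF sub] u by blast
      ultimately have "mon_poly d \<otimes>\<^bsub>poly_alg n\<^esub> Poly_Mapping.single a c \<in> ?L" by (rule L.I_r_closed[rotated])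
      then show ?case by (simp add: mon_poly_def mult_single u)
    next
      case (add f g)
      then show ?case using L.a_closed by simp
    qed
  qed
qed

lemma Idl_monomials_eq_iff:
  assumes "E \<subseteq> mons n" "F \<subseteq> mons n"
  shows "Idl\<^bsub>poly_alg n\<^esub> ((mon_poly :: mon \<Rightarrow> 'k::field poly) ` E) = Idl\<^bsub>poly_alg n\<^esub> (mon_poly ` F)
    \<longleftrightarrow> multiples n E = multiples n F"
proof -
  have "A = B" if "{p :: 'k poly. Poly_Mapping.keys p \<subseteq> A} = {p. Poly_Mapping.keys p \<subseteq> B}" for A B
  proof -
    have "e \<in> A \<longleftrightarrow> e \<in> B" for e
      using arg_cong[OF that, of "\<lambda>Z. Poly_Mapping.single e 1 \<in> Z"] by simp
    then show ?thesis by blast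
  qed
  then show ?thesis unfolding Idl_monomials[OF assms(1)] Idl_monomials[OF assms(2)] by auto
qed

text \<open>The generators that are minimal under divisibility; these turn out to be \<open>G(I)\<close>.\<close>

definition indivisible :: "mon set \<Rightarrow> mon set" where
  "indivisible E = {e\<in>E. \<forall>d\<in>E. \<forall>a. e = d + a \<longrightarrow> a = 0}"

text \<open>A proper divisor has smaller degree, so every generator is a multiple of an indivisible one.\<close>

lemma multiples_indivisible:
  assumes E: "E \<subseteq> mons n"
  shows "multiples n (indivisible E) = multiples n E"
proof -
  \<comment> \<open>The sum runs over all variables rather than over the support, so that it is additive by linearity.\<close>
  define sz where "sz e = (\<Sum>v\<in>{1..n}. Poly_Mapping.lookup e v)" for e :: mon
  have sz_zero: "a = 0" if "a \<in> mons n" "sz a = 0" for a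
  proof (rule poly_mapping_eqI)
    fix v
    show "Poly_Mapping.lookup a v = Poly_Mapping.lookup 0 v"
    proof (cases "v \<in> {1..n}")
      case True
      then show ?thesis using that(2) by (simp add: sz_def)
    next
      case False
      then have "v \<notin> Poly_Mapping.keys a" using that(1) by (auto simp: mons_def)
      then show ?thesis by (simp add: in_keys_iff)
    qed
  qed
  have sz_add: "sz (a + b) = sz a + sz b" for a b
    by (simp add: sz_def lookup_add sum.distrib)
  have "\<exists>d\<in>indivisible E. \<exists>a. e = d + a" if "e \<in> E" for e
    using that
  proof (induction "sz e" arbitrary: e rule: less_induct)
    case less
    show ?case
    proof (cases "e \<in> indivisible E")
      case True
      then show ?thesis by (intro bexI[of _ e] exI[of _ 0]) auto
    next
      case False
      with less.prems obtain d a where da: "d \<in> E" "e = d + a" "a \<noteq> 0" by (auto simp: indivisible_def)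
      then have "a \<in> mons n" using less.prems E mons_addD by blast
      with da have "sz d < sz e" using sz_zero sz_add by fastforce
      from less.hyps[OF this da(1)] show ?thesis unfolding da(2) by (metis add.assoc)
    qed
  qed
  then have "multiples n E \<subseteq> multiples n (indivisible E)"
    unfolding multiples_def by clarsimp (metis add.assoc)
  moreover have "multiples n (indivisible E) \<subseteq> multiples n E"
    unfolding multiples_def indivisible_def by blast
  ultimately show ?thesis by blast
qed

lemma mon_add_eq_zero: "(b::mon) + a = 0 \<Longrightarrow> a = 0"
  by (metis add_eq_0_iff_both_eq_0 lookup_add lookup_zero poly_mapping_eqI)

text \<open>A monomial that is indivisible in \<open>E\<close> has no proper divisor in the ideal, so it occurs in every
monomial generating set. Hence the indivisible monomials form the least such set, and the definite
description of \<open>G(I)\<close> is well defined.\<close>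

lemma min_gens_Idl:
  assumes E: "E \<subseteq> mons n"
  shows "min_gens n (Idl\<^bsub>poly_alg n\<^esub> ((mon_poly :: mon \<Rightarrow> 'k::field poly) ` E)) = indivisible E"
  unfolding min_gens_def
proof (rule the_equality; (elim conjE)?)
  let ?M = "indivisible E"
  have ME: "?M \<subseteq> E" by (auto simp: indivisible_def)
  show "?M \<subseteq> mons n \<and> Idl\<^bsub>poly_alg n\<^esub> ((mon_poly :: mon \<Rightarrow> 'k poly) ` ?M) = Idl\<^bsub>poly_alg n\<^esub> (mon_poly ` E) \<and>
    (\<forall>F\<subset>?M. Idl\<^bsub>poly_alg n\<^esub> ((mon_poly :: mon \<Rightarrow> 'k poly) ` F) \<noteq> Idl\<^bsub>poly_alg n\<^esub> (mon_poly ` E))"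
  proof (intro conjI allI impI notI)
    show M: "?M \<subseteq> mons n" using ME E by blast
    show "Idl\<^bsub>poly_alg n\<^esub> ((mon_poly :: mon \<Rightarrow> 'k poly) ` ?M) = Idl\<^bsub>poly_alg n\<^esub> (mon_poly ` E)"
      by (simp add: Idl_monomials_eq_iff M E multiples_indivisible)
    fix F assume F: "F \<subset> ?M"
    then obtain e where e: "e \<in> ?M" "e \<notin> F" by blast
    assume "Idl\<^bsub>poly_alg n\<^esub> ((mon_poly :: mon \<Rightarrow> 'k poly) ` F) = Idl\<^bsub>poly_alg n\<^esub> (mon_poly ` E)"
    moreover have "F \<subseteq> mons n" using F M by blast
    ultimately have "multiples n F = multiples n E" by (simp add: Idl_monomials_eq_iff E)
    then have "e \<in> multiples n F" using multiples_self[OF E] e(1) ME by blast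
    then obtain d a where "d \<in> F" "e = d + a" by (auto simp: multiples_def)
    moreover from this have "a = 0" using e(1) F unfolding indivisible_def by blast
    ultimately show False using e by simp
  qed
  fix E' assume E': "E' \<subseteq> mons n"
    and "Idl\<^bsub>poly_alg n\<^esub> ((mon_poly :: mon \<Rightarrow> 'k poly) ` E') = Idl\<^bsub>poly_alg n\<^esub> (mon_poly ` E)"
    and min: "\<forall>F. F \<subset> E' \<longrightarrow> Idl\<^bsub>poly_alg n\<^esub> ((mon_poly :: mon \<Rightarrow> 'k poly) ` F) \<noteq> Idl\<^bsub>poly_alg n\<^esub> (mon_poly ` E)"
  then have eq: "multiples n E' = multiples n E" by (simp add: Idl_monomials_eq_iff E)
  have "?M \<subseteq> E'"
  proof
    fix e assume e: "e \<in> ?M"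
    then have "e \<in> multiples n E'" unfolding eq using multiples_self[OF E] ME by blast
    then obtain d a where d: "d \<in> E'" "e = d + a" by (auto simp: multiples_def)
    have "d \<in> multiples n E'" using multiples_self[OF E'] d by blast
    then obtain d' b where d': "d' \<in> E" "d = d' + b" unfolding eq by (auto simp: multiples_def)
    have "e = d' + (b + a)" using d d' by (simp add: add.assoc)
    then have "b + a = 0" using e d'(1) unfolding indivisible_def by blast
    then have "a = 0" by (rule mon_add_eq_zero)
    then show "e \<in> E'" using d by simp
  qed
  moreover have "Idl\<^bsub>poly_alg n\<^esub> ((mon_poly :: mon \<Rightarrow> 'k poly) ` ?M) = Idl\<^bsub>poly_alg n\<^esub> (mon_poly ` E)"
    using ME E by (simp add: Idl_monomials_eq_iff multiples_indivisible)
  ultimately show "E' = ?M" using min by blast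
qed

section \<open>The free module underlying the tensor product\<close>

lemma tensor_free_simps [simp]:
  "carrier (tensor_free S R) = {f. Poly_Mapping.keys f \<subseteq> (\<Pi>\<^sub>E i\<in>S. carrier (R i))}"
  "one (tensor_free S R) = Poly_Mapping.single (\<lambda>i\<in>S. \<one>\<^bsub>R i\<^esub>) 1"
  "ring.zero (tensor_free S R) = 0" "add (tensor_free S R) = (+)"
  "smult (tensor_free S R) = (\<lambda>c. Poly_Mapping.map ((*) c))"
  by (simp_all add: tensor_free_def)

definition pure_mult :: "'i set \<Rightarrow> ('i \<Rightarrow> ('k, 'a) module) \<Rightarrow> ('i \<Rightarrow> 'a) \<Rightarrow> ('i \<Rightarrow> 'a) \<Rightarrow> ('i \<Rightarrow> 'a)" where
  "pure_mult S R u v = (\<lambda>i\<in>S. u i \<otimes>\<^bsub>R i\<^esub> v i)"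

lemma tensor_mult_eq:
  "f \<otimes>\<^bsub>tensor_free S R\<^esub> g =
    lin_ext (\<lambda>u a. lin_ext (\<lambda>v b. Poly_Mapping.single (pure_mult S R u v) (a * b)) g) f"
  by (simp add: tensor_free_def lin_ext_def pure_mult_def)

lemma tensor_mult_single [simp]:
  "Poly_Mapping.single u a \<otimes>\<^bsub>tensor_free S R\<^esub> Poly_Mapping.single v b =
    Poly_Mapping.single (pure_mult S R u v) (a * b)"
  unfolding tensor_mult_eq by (subst lin_ext_single; simp add: lin_ext_def)+

lemma tensor_mult_zero [simp]:
  "0 \<otimes>\<^bsub>tensor_free S R\<^esub> g = 0" "f \<otimes>\<^bsub>tensor_free S R\<^esub> 0 = 0"
  by (simp_all add: tensor_mult_eq) (simp add: lin_ext_def)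

lemma tensor_mult_add:
  fixes R :: "'i \<Rightarrow> ('k::comm_ring_1, 'a) module"
  shows "(f + f') \<otimes>\<^bsub>tensor_free S R\<^esub> g = f \<otimes>\<^bsub>tensor_free S R\<^esub> g + f' \<otimes>\<^bsub>tensor_free S R\<^esub> g"
  "f \<otimes>\<^bsub>tensor_free S R\<^esub> (g + g') = f \<otimes>\<^bsub>tensor_free S R\<^esub> g + f \<otimes>\<^bsub>tensor_free S R\<^esub> g'"
proof -
  have add: "lin_ext (\<lambda>v b. Poly_Mapping.single (pure_mult S R u v) (a * b)) (h + h') =
      lin_ext (\<lambda>v b. Poly_Mapping.single (pure_mult S R u v) (a * b)) h +
      lin_ext (\<lambda>v b. Poly_Mapping.single (pure_mult S R u v) (a * b)) h'"
    for u and a :: 'k and h h'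
    by (rule lin_ext_add) (simp_all add: distrib_left single_add)
  show "f \<otimes>\<^bsub>tensor_free S R\<^esub> (g + g') = f \<otimes>\<^bsub>tensor_free S R\<^esub> g + f \<otimes>\<^bsub>tensor_free S R\<^esub> g'"
    unfolding tensor_mult_eq by (simp add: add lin_ext_sum)
  show "(f + f') \<otimes>\<^bsub>tensor_free S R\<^esub> g = f \<otimes>\<^bsub>tensor_free S R\<^esub> g + f' \<otimes>\<^bsub>tensor_free S R\<^esub> g"
    unfolding tensor_mult_eq
    by (rule lin_ext_add) (simp_all add: lin_ext_def distrib_right single_add sum.distrib)
qed

lemma tensor_mult_diff:
  "(f - f') \<otimes>\<^bsub>tensor_free S R\<^esub> g = f \<otimes>\<^bsub>tensor_free S R\<^esub> g - f' \<otimes>\<^bsub>tensor_free S R\<^esub> g"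
  "f \<otimes>\<^bsub>tensor_free S R\<^esub> (g - g') = f \<otimes>\<^bsub>tensor_free S R\<^esub> g - f \<otimes>\<^bsub>tensor_free S R\<^esub> g'"
  using tensor_mult_add(1)[of S R "f - f'" f' g] tensor_mult_add(2)[of S R f "g - g'" g']
  by (simp_all add: algebra_simps)

lemma pure_mult_closed:
  assumes "\<And>i. i \<in> S \<Longrightarrow> monoid (R i)"
    and "u \<in> (\<Pi>\<^sub>E i\<in>S. carrier (R i))" "v \<in> (\<Pi>\<^sub>E i\<in>S. carrier (R i))"
  shows "pure_mult S R u v \<in> (\<Pi>\<^sub>E i\<in>S. carrier (R i))"
  using assms by (auto simp: pure_mult_def intro!: monoid.m_closed)

lemma pure_mult_one:
  assumes "\<And>i. i \<in> S \<Longrightarrow> monoid (R i)" and u: "u \<in> (\<Pi>\<^sub>E i\<in>S. carrier (R i))"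
  shows "pure_mult S R (\<lambda>i\<in>S. \<one>\<^bsub>R i\<^esub>) u = u" "pure_mult S R u (\<lambda>i\<in>S. \<one>\<^bsub>R i\<^esub>) = u"
  using u by (auto simp: pure_mult_def fun_eq_iff intro: PiE_arb[symmetric]
    monoid.l_one[OF assms(1)] monoid.r_one[OF assms(1)] PiE_mem)

text \<open>The free module is the monoid algebra of the product of the multiplicative monoids of the factors;
the laws hold for basis elements and extend by bilinearity.\<close>

lemma ring_tensor_free:
  fixes R :: "'i \<Rightarrow> ('k::comm_ring_1, 'a) module"
  assumes R: "\<And>i. i \<in> S \<Longrightarrow> monoid (R i)"
  shows "ring (tensor_free S R)"
proof (rule ringI)
  let ?T = "tensor_free S R" and ?B = "\<Pi>\<^sub>E i\<in>S. carrier (R i)"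
  show "abelian_group ?T"
  proof (rule abelian_groupI)
    fix x assume "x \<in> carrier ?T"
    then show "\<exists>y\<in>carrier ?T. y \<oplus>\<^bsub>?T\<^esub> x = \<zero>\<^bsub>?T\<^esub>" by (intro bexI[of _ "- x"]) auto
  qed (simp_all add: add_ac keys_add_subset)
  have closed: "Poly_Mapping.keys (f \<otimes>\<^bsub>?T\<^esub> g) \<subseteq> ?B"
    if "Poly_Mapping.keys f \<subseteq> ?B" "Poly_Mapping.keys g \<subseteq> ?B" for f g
    using that(1)
  proof (induction f rule: poly_mapping_supp_induct)
    case (single u c)
    from that(2) show ?case
      by (induction g rule: poly_mapping_supp_induct)
        (use single pure_mult_closed[of S R, OF R] in \<open>simp_all add: tensor_mult_add keys_add_subset\<close>)
  qed (simp_all add: tensor_mult_add keys_add_subset)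
  have one: "(\<lambda>i\<in>S. \<one>\<^bsub>R i\<^esub>) \<in> ?B" using R by (auto intro: monoid.one_closed)
  show "monoid ?T"
  proof (rule monoidI)
    fix x y z assume xyz: "x \<in> carrier ?T" "y \<in> carrier ?T" "z \<in> carrier ?T"
    then have "Poly_Mapping.keys x \<subseteq> ?B" by simp
    then show "x \<otimes>\<^bsub>?T\<^esub> y \<otimes>\<^bsub>?T\<^esub> z = x \<otimes>\<^bsub>?T\<^esub> (y \<otimes>\<^bsub>?T\<^esub> z)"
    proof (induction x rule: poly_mapping_supp_induct)
      case (single u a)
      note u = this
      from xyz have "Poly_Mapping.keys y \<subseteq> ?B" by simp
      then show ?case
      proof (induction y rule: poly_mapping_supp_induct)
        case (single v b)
        note v = this
        from xyz have "Poly_Mapping.keys z \<subseteq> ?B" by simp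
        then show ?case
        proof (induction z rule: poly_mapping_supp_induct)
          case (single w c)
          have "pure_mult S R (pure_mult S R u v) w = pure_mult S R u (pure_mult S R v w)"
            using u v single by (auto simp: pure_mult_def fun_eq_iff PiE_mem intro!: monoid.m_assoc[OF R])
          then show ?case by (simp add: mult.assoc)
        qed (simp_all add: tensor_mult_add)
      qed (simp_all add: tensor_mult_add)
    qed (simp_all add: tensor_mult_add)
  next
    fix x assume "x \<in> carrier ?T"
    then have "Poly_Mapping.keys x \<subseteq> ?B" by simp
    then have "\<one>\<^bsub>?T\<^esub> \<otimes>\<^bsub>?T\<^esub> x = x \<and> x \<otimes>\<^bsub>?T\<^esub> \<one>\<^bsub>?T\<^esub> = x"
      by (induction x rule: poly_mapping_supp_induct)
        (simp_all add: tensor_mult_add pure_mult_one[OF R])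
    then show "\<one>\<^bsub>?T\<^esub> \<otimes>\<^bsub>?T\<^esub> x = x" "x \<otimes>\<^bsub>?T\<^esub> \<one>\<^bsub>?T\<^esub> = x" by simp_all
  qed (use closed one in simp_all)
qed (simp_all add: tensor_mult_add)

lemma tensor_smult_eq:
  fixes R :: "'i \<Rightarrow> ('k::comm_ring_1, 'a) module"
  assumes R: "\<And>i. i \<in> S \<Longrightarrow> monoid (R i)" and f: "f \<in> carrier (tensor_free S R)"
  shows "c \<odot>\<^bsub>tensor_free S R\<^esub> f =
    Poly_Mapping.single (\<lambda>i\<in>S. \<one>\<^bsub>R i\<^esub>) c \<otimes>\<^bsub>tensor_free S R\<^esub> f"
proof -
  have map_add: "Poly_Mapping.map ((*) c) (g + h) = Poly_Mapping.map ((*) c) g + Poly_Mapping.map ((*) c) h"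
    for g h :: "('i \<Rightarrow> 'a) \<Rightarrow>\<^sub>0 'k"
    by (rule poly_mapping_eqI) (auto simp: map.rep_eq lookup_add when_def simp flip: distrib_left)
  from f have "Poly_Mapping.keys f \<subseteq> (\<Pi>\<^sub>E i\<in>S. carrier (R i))" by simp
  then show ?thesis
  proof (induction f rule: poly_mapping_supp_induct)
    case zero
    show ?case by (simp, rule poly_mapping_eqI) (simp add: map.rep_eq)
  next
    case (single u a)
    then show ?case by (simp add: pure_mult_one[OF R] del: restrict_apply)
  qed (simp_all add: map_add tensor_mult_add)
qed

section \<open>Tensor decomposition of a monomial ring\<close>

text \<open>The decomposition rests on two properties of monomials: their monoid is the internal direct sum of
the monoids of monomials of the factors (embeddings \<open>incl i\<close>, projections \<open>proj i\<close>), and a monomial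
lies in \<open>I\<close> iff one of its components lies in the corresponding \<open>J i\<close>.\<close>

locale monomial_splitting =
  fixes S :: "'i set" and n :: nat and N :: "'i \<Rightarrow> nat"
    and incl proj :: "'i \<Rightarrow> mon \<Rightarrow> mon"
    and E :: "mon set" and F :: "'i \<Rightarrow> mon set"
    and I :: "'k::field poly set" and J :: "'i \<Rightarrow> 'k poly set"
  assumes finite_S: "finite S"
    and incl_zero: "incl i 0 = 0" and incl_add: "incl i (a + b) = incl i a + incl i b"
    and incl_mons: "i \<in> S \<Longrightarrow> d \<in> mons (N i) \<Longrightarrow> incl i d \<in> mons n"
    and proj_add: "proj i (a + b) = proj i a + proj i b"
    and proj_mons: "i \<in> S \<Longrightarrow> proj i e \<in> mons (N i)"
    and proj_incl: "i \<in> S \<Longrightarrow> j \<in> S \<Longrightarrow> d \<in> mons (N i) \<Longrightarrow> proj j (incl i d) = (if j = i then d else 0)"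
    and sum_incl_proj: "e \<in> mons n \<Longrightarrow> (\<Sum>i\<in>S. incl i (proj i e)) = e"
    and multiples_iff: "e \<in> mons n \<Longrightarrow> e \<in> multiples n E \<longleftrightarrow> (\<exists>i\<in>S. proj i e \<in> multiples (N i) (F i))"
    and I_eq: "I = {p. Poly_Mapping.keys p \<subseteq> multiples n E}"
    and J_eq: "J i = {p. Poly_Mapping.keys p \<subseteq> multiples (N i) (F i)}"
begin

lemma ideal_I: "ideal I (poly_alg n)"
  unfolding I_eq by (rule keys_subset_ideal) (auto simp: multiples_add, auto simp: multiples_def)

lemma ideal_J: "ideal (J i) (poly_alg (N i))"
  unfolding J_eq by (rule keys_subset_ideal) (auto simp: multiples_add, auto simp: multiples_def)

abbreviation factor :: "'i \<Rightarrow> ('k, 'k poly set) module" where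
  "factor i \<equiv> quot_alg (poly_alg (N i)) (J i)"

abbreviation coset :: "'i \<Rightarrow> 'k poly \<Rightarrow> 'k poly set" where
  "coset i p \<equiv> J i +>\<^bsub>poly_alg (N i)\<^esub> p"

abbreviation "T \<equiv> tensor_free S factor"
abbreviation "K \<equiv> Idl\<^bsub>T\<^esub> (tensor_relations S factor)"
abbreviation "pures \<equiv> \<Pi>\<^sub>E i\<in>S. carrier (factor i)"

lemma coset_closed: "Poly_Mapping.keys p \<subseteq> mons (N i) \<Longrightarrow> coset i p \<in> carrier (factor i)"
  by (auto simp: FactRing_def A_RCOSETS_def')

lemma factor_cases:
  assumes "x \<in> carrier (factor i)"
  obtains p where "Poly_Mapping.keys p \<subseteq> mons (N i)" "x = coset i p"
  using assms by (auto simp: FactRing_def A_RCOSETS_def')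

lemma
  assumes "Poly_Mapping.keys p \<subseteq> mons (N i)"
  shows coset_mult: "Poly_Mapping.keys q \<subseteq> mons (N i) \<Longrightarrow> coset i p \<otimes>\<^bsub>factor i\<^esub> coset i q = coset i (p * q)"
    and coset_add: "Poly_Mapping.keys q \<subseteq> mons (N i) \<Longrightarrow> coset i p \<oplus>\<^bsub>factor i\<^esub> coset i q = coset i (p + q)"
    and coset_smult: "c \<odot>\<^bsub>factor i\<^esub> coset i p = coset i (Poly_Mapping.single 0 c * p)"
proof -
  note hom = ideal.rcos_ring_hom[OF ideal_J, of i]
  show "coset i p \<otimes>\<^bsub>factor i\<^esub> coset i q = coset i (p * q)" if "Poly_Mapping.keys q \<subseteq> mons (N i)"
    using ring_hom_mult[OF hom, of p q] assms that by simp
  show "coset i p \<oplus>\<^bsub>factor i\<^esub> coset i q = coset i (p + q)" if "Poly_Mapping.keys q \<subseteq> mons (N i)"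
    using ring_hom_add[OF hom, of p q] assms that by simp
  show "c \<odot>\<^bsub>factor i\<^esub> coset i p = coset i (Poly_Mapping.single 0 c * p)"
    by (subst quot_alg_smult[OF ideal_J, where s = "Poly_Mapping.single 0 c"]) (use assms in auto)
qed

lemma coset_one: "coset i 1 = \<one>\<^bsub>factor i\<^esub>"
  using ring_hom_one[OF ideal.rcos_ring_hom[OF ideal_J, of i]] by simp

lemma coset_eq: "coset i p = coset i q \<longleftrightarrow> p - q \<in> J i"
  by (rule coset_eq_iff[OF ideal_J]) simp_all

lemma ring_T: "ring T"
  by (rule ring_tensor_free) (rule monoid_quot_alg[OF ideal_J])

lemma upd_pures: "u \<in> pures \<Longrightarrow> i \<in> S \<Longrightarrow> x \<in> carrier (factor i) \<Longrightarrow> u(i := x) \<in> pures"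
  by (auto simp: PiE_iff extensional_def)

lemma relations_subset: "tensor_relations S factor \<subseteq> carrier T"
proof -
  have add: "x \<oplus>\<^bsub>factor i\<^esub> y \<in> carrier (factor i)" if "x \<in> carrier (factor i)" "y \<in> carrier (factor i)" for i x y
    using that by (elim factor_cases) (simp only: coset_add coset_closed keys_add_subset)
  have smult: "c \<odot>\<^bsub>factor i\<^esub> x \<in> carrier (factor i)" if "x \<in> carrier (factor i)" for i c x
  proof -
    obtain p where p: "Poly_Mapping.keys p \<subseteq> mons (N i)" "x = coset i p" using \<open>x \<in> _\<close> by (rule factor_cases)
    have "Poly_Mapping.keys (Poly_Mapping.single 0 c * p) \<subseteq> mons (N i)"
      by (rule keys_mult_mons) (use p in auto)
    then show ?thesis unfolding p(2) coset_smult[OF p(1)] by (rule coset_closed)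
  qed
  have single: "Poly_Mapping.keys (Poly_Mapping.single u c) \<subseteq> pures" if "u \<in> pures" for u and c :: 'k
    using that by simp
  show ?thesis
    unfolding tensor_relations_def tensor_free_simps
    by (intro Un_least subsetI; elim CollectE exE conjE, hypsubst,
      intro CollectI keys_diff_subset single upd_pures add smult; assumption)
qed

lemma ideal_K: "ideal K T"
  by (rule ring.genideal_ideal[OF ring_T relations_subset])

lemmas K_closed = ideal_zero[OF ideal_K tensor_free_simps(4,3)] ideal_add[OF ideal_K tensor_free_simps(4,3)]

lemma scalar_closed: "Poly_Mapping.single (\<lambda>i\<in>S. \<one>\<^bsub>factor i\<^esub>) c \<in> carrier T"
proof -
  have "(\<lambda>i\<in>S. \<one>\<^bsub>factor i\<^esub>) \<in> pures"
    using monoid.one_closed[OF monoid_quot_alg[OF ideal_J]] by auto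
  then show ?thesis by simp
qed

text \<open>The defining relations carry coefficient \<open>1\<close>. Multiplying by scalars, which are multiples of the unit
tensor, gives the same relations with an arbitrary coefficient.\<close>

lemma K_scale_relation:
  assumes "f \<in> K" shows "Poly_Mapping.single (\<lambda>i\<in>S. \<one>\<^bsub>factor i\<^esub>) c \<otimes>\<^bsub>T\<^esub> f \<in> K"
  by (rule ideal.I_l_closed[OF ideal_K assms scalar_closed])

lemma K_add_slot:
  assumes u: "u \<in> pures" "j \<in> S" and p: "Poly_Mapping.keys p \<subseteq> mons (N j)" and q: "Poly_Mapping.keys q \<subseteq> mons (N j)"
  shows "Poly_Mapping.single (u(j := coset j (p + q))) c - Poly_Mapping.single (u(j := coset j p)) c
    - Poly_Mapping.single (u(j := coset j q)) c \<in> K"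
proof -
  let ?f = "Poly_Mapping.single (u(j := coset j (p + q))) 1 - Poly_Mapping.single (u(j := coset j p)) 1
    - Poly_Mapping.single (u(j := coset j q)) (1::'k)"
  have "?f \<in> tensor_relations S factor"
    unfolding tensor_relations_def coset_add[OF p q, symmetric] using u coset_closed[OF p] coset_closed[OF q] by blast
  then have "?f \<in> K" using ring.genideal_self[OF ring_T relations_subset] by blast
  moreover have "u(j := coset j r) \<in> pures" if "Poly_Mapping.keys r \<subseteq> mons (N j)" for r
    by (rule upd_pures[OF u coset_closed[OF that]])
  ultimately show ?thesis using K_scale_relation[of ?f c] p q
    by (simp add: tensor_mult_diff pure_mult_one monoid_quot_alg[OF ideal_J] keys_add_subset
      del: quot_alg_simps restrict_apply)
qed

lemma K_scale_slot:
  assumes u: "u \<in> pures" "j \<in> S" and p: "Poly_Mapping.keys p \<subseteq> mons (N j)"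
  shows "Poly_Mapping.single (u(j := coset j (Poly_Mapping.single 0 b * p))) c
    - Poly_Mapping.single (u(j := coset j p)) (c * b) \<in> K"
proof -
  let ?f = "Poly_Mapping.single (u(j := coset j (Poly_Mapping.single 0 b * p))) 1
    - Poly_Mapping.single (u(j := coset j p)) b"
  have "?f \<in> tensor_relations S factor"
    unfolding tensor_relations_def coset_smult[OF p, symmetric] using u coset_closed[OF p] by blast
  then have "?f \<in> K" using ring.genideal_self[OF ring_T relations_subset] by blast
  moreover have "u(j := coset j r) \<in> pures" if "Poly_Mapping.keys r \<subseteq> mons (N j)" for r
    by (rule upd_pures[OF u coset_closed[OF that]])
  moreover have "Poly_Mapping.keys (Poly_Mapping.single 0 b * p) \<subseteq> mons (N j)"
    by (rule keys_mult_mons) (use p in auto)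
  ultimately show ?thesis using K_scale_relation[of ?f c] p
    by (simp add: tensor_mult_diff pure_mult_one monoid_quot_alg[OF ideal_J]
      del: quot_alg_simps restrict_apply)
qed

lemma K_zero_slot:
  assumes "u \<in> pures" "j \<in> S"
  shows "Poly_Mapping.single (u(j := coset j 0)) c \<in> K"
  using K_scale_slot[OF assms, of 0 0 c] by simp

text \<open>The pure tensor corresponding to a monomial. Its linear extension \<open>push pure_of\<close> is the ring
homomorphism from the polynomial ring that induces the isomorphism.\<close>

definition pure_of :: "mon \<Rightarrow> ('i \<Rightarrow> 'k poly set)" where
  "pure_of e = (\<lambda>i\<in>S. coset i (mon_poly (proj i e)))"

lemma proj_zero: "proj i 0 = 0"
  using proj_add[of i 0 0] by simp

lemma pure_of_pures: "pure_of e \<in> pures"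
  by (auto simp: pure_of_def proj_mons mon_poly_def simp del: quot_alg_simps intro!: coset_closed)

lemma pure_of_zero: "pure_of 0 = (\<lambda>i\<in>S. \<one>\<^bsub>factor i\<^esub>)"
  by (auto simp: pure_of_def proj_zero mon_poly_def coset_one simp del: quot_alg_simps)

lemma pure_of_add: "pure_of (a + b) = pure_mult S factor (pure_of a) (pure_of b)"
proof -
  have "coset i (mon_poly (proj i (a + b))) = coset i (mon_poly (proj i a)) \<otimes>\<^bsub>factor i\<^esub> coset i (mon_poly (proj i b))"
    if "i \<in> S" for i
    using that by (subst coset_mult) (auto simp: mon_poly_def proj_mons proj_add mult_single)
  then show ?thesis by (auto simp: pure_of_def pure_mult_def fun_eq_iff simp del: quot_alg_simps)
qed

lemma push_pure_of_closed: "Poly_Mapping.keys (push pure_of p) \<subseteq> pures"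
  using keys_push[of pure_of p] pure_of_pures by blast

lemma push_pure_of_mult: "push pure_of (p * q) = push pure_of p \<otimes>\<^bsub>T\<^esub> push pure_of (q :: 'k poly)"
proof (rule poly_mapping_supp_induct[of p UNIV])
  fix u c
  show "push pure_of (Poly_Mapping.single u c * q) = push pure_of (Poly_Mapping.single u c) \<otimes>\<^bsub>T\<^esub> push pure_of q"
    by (rule poly_mapping_supp_induct[of q UNIV])
      (auto simp: mult_single push_add tensor_mult_add distrib_left pure_of_add)
qed (auto simp: push_add tensor_mult_add distrib_right)

lemma push_pure_of_smult: "push pure_of (Poly_Mapping.single 0 c * p) = c \<odot>\<^bsub>T\<^esub> push pure_of p"
proof -
  have "c \<odot>\<^bsub>T\<^esub> push pure_of p = Poly_Mapping.single (\<lambda>i\<in>S. \<one>\<^bsub>factor i\<^esub>) c \<otimes>\<^bsub>T\<^esub> push pure_of p"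
    by (rule tensor_smult_eq) (use push_pure_of_closed in \<open>auto simp del: quot_alg_simps intro: monoid_quot_alg[OF ideal_J]\<close>)
  then show ?thesis by (simp only: push_pure_of_mult push_single pure_of_zero)
qed

text \<open>A monomial in \<open>I\<close> has a component in some \<open>J i\<close>, so its pure tensor has a zero entry.\<close>

lemma push_I_in_K:
  assumes "p \<in> I" shows "push pure_of p \<in> K"
proof -
  from assms have "Poly_Mapping.keys p \<subseteq> multiples n E" by (simp add: I_eq)
  then show ?thesis
  proof (induction p rule: poly_mapping_supp_induct)
    case zero
    show ?case using K_closed(1) by simp
  next
    case (single e c)
    then obtain i where i: "i \<in> S" "proj i e \<in> multiples (N i) (F i)"
      using multiples_iff[of e] by (auto simp: multiples_def)
    then have "coset i (mon_poly (proj i e)) = coset i 0" unfolding coset_eq by (simp add: J_eq mon_poly_def)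
    then have "(pure_of e)(i := coset i 0) = pure_of e" using i by (auto simp: pure_of_def fun_eq_iff)
    with K_zero_slot[OF pure_of_pures i(1), of e c] show ?case by simp
  next
    case (add f g)
    then show ?case using K_closed(2) by (simp add: push_add)
  qed
qed

lemma proj_sum_incl:
  assumes "\<And>i. i \<in> S \<Longrightarrow> e i \<in> mons (N i)" "j \<in> S"
  shows "proj j (\<Sum>i\<in>S. incl i (e i)) = e j"
proof -
  have "proj j (\<Sum>i\<in>A. incl i (e i)) = (\<Sum>i\<in>A. if j = i then e i else 0)" if "A \<subseteq> S" for A
    using finite_subset[OF that finite_S] that
    by (induction A rule: finite_induct) (auto simp: proj_zero proj_add proj_incl assms)
  then show ?thesis using assms(2) finite_S by simp
qed

text \<open>Every pure tensor is congruent to the image of a polynomial. The entries outside \<open>A\<close> are classes of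
monomials; the entry at a further index is expanded into monomials by linearity in that entry. When
\<open>A\<close> is empty, the tensor is the image of a single monomial.\<close>

lemma single_mod_K:
  assumes "finite A" "A \<subseteq> S" "u \<in> pures"
    and "\<And>i. i \<in> S - A \<Longrightarrow> \<exists>e\<in>mons (N i). u i = coset i (mon_poly e)"
  shows "\<exists>p. Poly_Mapping.keys p \<subseteq> mons n \<and> Poly_Mapping.single u c - push pure_of p \<in> K"
  using assms
proof (induction A arbitrary: u c rule: finite_induct)
  case empty
  then have "\<forall>i\<in>S. \<exists>e. e \<in> mons (N i) \<and> u i = coset i (mon_poly e)" by blast
  from bchoice[OF this] obtain e
    where e: "\<And>i. i \<in> S \<Longrightarrow> e i \<in> mons (N i)" "\<And>i. i \<in> S \<Longrightarrow> u i = coset i (mon_poly (e i))"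
    by blast
  let ?e = "\<Sum>i\<in>S. incl i (e i)"
  have "pure_of ?e = u"
  proof (rule ext)
    fix i
    show "pure_of ?e i = u i"
      by (cases "i \<in> S") (simp_all add: pure_of_def proj_sum_incl[OF e(1)] e(2) PiE_arb[OF empty.prems(2)])
  qed
  moreover have "?e \<in> mons n" using e incl_mons by (intro mons_sum) blast
  ultimately show ?case using K_closed(1) by (intro exI[of _ "Poly_Mapping.single ?e c"]) auto
next
  case (insert j A)
  have j: "j \<in> S" using insert.prems by simp
  obtain q where q: "Poly_Mapping.keys q \<subseteq> mons (N j)" "u j = coset j q"
    using PiE_mem[OF insert.prems(2) j] by (rule factor_cases)
  from q(1) have "\<exists>p. Poly_Mapping.keys p \<subseteq> mons n \<and>
    Poly_Mapping.single (u(j := coset j q)) c - push pure_of p \<in> K"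
  proof (induction q rule: poly_mapping_supp_induct)
    case zero
    show ?case using K_zero_slot[OF insert.prems(2) j] by (intro exI[of _ 0]) (simp del: fun_upd_apply)
  next
    case (single e b)
    let ?u = "u(j := coset j (mon_poly e))"
    have e: "Poly_Mapping.keys (mon_poly e :: 'k poly) \<subseteq> mons (N j)" using single by (simp add: mon_poly_def)
    have others: "\<exists>e\<in>mons (N i). ?u i = coset i (mon_poly e)" if "i \<in> S - A" for i
      using that insert.prems(3)[of i] single by (cases "i = j") auto
    then obtain p where p: "Poly_Mapping.keys p \<subseteq> mons n" "Poly_Mapping.single ?u (c * b) - push pure_of p \<in> K"
      using insert.IH[of ?u "c * b", OF _ upd_pures[OF insert.prems(2) j coset_closed[OF e]] others] insert.prems(1)
      by blast
    have "Poly_Mapping.single e b = Poly_Mapping.single 0 b * (mon_poly e :: 'k poly)"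
      by (simp add: mon_poly_def mult_single)
    with K_scale_slot[OF insert.prems(2) j e, of b c]
    have "Poly_Mapping.single (u(j := coset j (Poly_Mapping.single e b))) c - Poly_Mapping.single ?u (c * b) \<in> K"
      by simp
    from K_closed(2)[OF this p(2)] p(1) show ?case by (intro exI[of _ p]) (simp del: fun_upd_apply)
  next
    case (add f g)
    then obtain p p' where p: "Poly_Mapping.keys p \<subseteq> mons n" "Poly_Mapping.keys p' \<subseteq> mons n"
      "Poly_Mapping.single (u(j := coset j f)) c - push pure_of p \<in> K"
      "Poly_Mapping.single (u(j := coset j g)) c - push pure_of p' \<in> K"
      by blast
    have "Poly_Mapping.single (u(j := coset j (f + g))) c - push pure_of (p + p') \<in> K"
      using K_closed(2)[OF K_closed(2)[OF K_add_slot[OF insert.prems(2) j add.hyps, of c] p(3)] p(4)]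
      by (simp add: push_add algebra_simps del: fun_upd_apply)
    then show ?case using keys_add_subset[OF p(1,2)] by blast
  qed
  moreover have "u(j := coset j q) = u" by (simp only: q(2)[symmetric] fun_upd_triv)
  ultimately show ?case by simp
qed

lemma mod_K:
  assumes "f \<in> carrier T"
  shows "\<exists>p. Poly_Mapping.keys p \<subseteq> mons n \<and> f - push pure_of p \<in> K"
proof -
  from assms have "Poly_Mapping.keys f \<subseteq> pures" by simp
  then show ?thesis
  proof (induction f rule: poly_mapping_supp_induct)
    case zero
    show ?case using K_closed(1) by (intro exI[of _ 0]) auto
  next
    case (single u c)
    then show ?case using single_mod_K[OF finite_S, of u c] by blast
  next
    case (add f g)
    then obtain p p' where p: "Poly_Mapping.keys p \<subseteq> mons n" "Poly_Mapping.keys p' \<subseteq> mons n"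
      "f - push pure_of p \<in> K" "g - push pure_of p' \<in> K"
      by blast
    have "f + g - push pure_of (p + p') \<in> K"
      using K_closed(2)[OF p(3,4)] by (simp add: push_add algebra_simps)
    then show ?case using keys_add_subset[OF p(1,2)] by blast
  qed
qed

lemmas I_closed = ideal_zero[OF ideal_I poly_alg_simps(5,4)] ideal_add[OF ideal_I poly_alg_simps(5,4)]
  ideal_diff[OF ideal_I poly_alg_simps(5,4)] ideal_uminus[OF ideal_I poly_alg_simps(5,4)]

lemma I_mult: "p \<in> I \<Longrightarrow> Poly_Mapping.keys q \<subseteq> mons n \<Longrightarrow> p * q \<in> I"
  using ideal.I_r_closed[OF ideal_I, of p q] by simp

lemma I_carrier: "p \<in> I \<Longrightarrow> Poly_Mapping.keys p \<subseteq> mons n"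
  by (auto simp: I_eq multiples_def)

lemma mult_cong_I:
  assumes "a - a' \<in> I" "b - b' \<in> I" "Poly_Mapping.keys b \<subseteq> mons n" "Poly_Mapping.keys a' \<subseteq> mons n"
  shows "a * b - a' * b' \<in> I"
proof -
  have "(a - a') * b + (b - b') * a' \<in> I" using assms by (intro I_closed(2) I_mult)
  then show ?thesis by (simp add: algebra_simps)
qed

lemma keys_prod_mons:
  "(\<And>i. i \<in> A \<Longrightarrow> Poly_Mapping.keys (a i) \<subseteq> mons n) \<Longrightarrow> Poly_Mapping.keys (prod a A :: 'k poly) \<subseteq> mons n"
  by (induction A rule: infinite_finite_induct) (simp_all add: keys_mult_mons)

lemma prod_cong_I:
  assumes "finite A" "\<And>i. i \<in> A \<Longrightarrow> a i - b i \<in> I"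
    "\<And>i. i \<in> A \<Longrightarrow> Poly_Mapping.keys (a i) \<subseteq> mons n" "\<And>i. i \<in> A \<Longrightarrow> Poly_Mapping.keys (b i) \<subseteq> mons n"
  shows "prod a A - prod b A \<in> I"
  using assms
proof (induction A rule: finite_induct)
  case empty
  show ?case using I_closed(1) by simp
next
  case (insert x A)
  then have "a x * prod a A - b x * prod b A \<in> I" by (intro mult_cong_I keys_prod_mons) simp_all
  then show ?case using insert.hyps by simp
qed

text \<open>From here on a map in the other direction is built, which shows that the kernel is not larger than \<open>I\<close>:
the entries of a pure tensor are represented by polynomials, which are multiplied in the big
polynomial ring. The result depends on the representatives only modulo \<open>I\<close>.\<close>

definition embed :: "'i \<Rightarrow> 'k poly \<Rightarrow> 'k poly" where
  "embed i = push (incl i)"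

lemma embed_simps [simp]: "embed i 0 = 0" "embed i (Poly_Mapping.single d c) = Poly_Mapping.single (incl i d) c"
  by (simp_all add: embed_def)

lemma embed_add: "embed i (p + q) = embed i p + embed i q"
  and embed_diff: "embed i (p - q) = embed i p - embed i q"
  and embed_mult: "embed i (p * q) = embed i p * embed i q"
  by (simp_all add: embed_def push_add push_diff push_mult incl_add)

lemma embed_closed:
  "i \<in> S \<Longrightarrow> Poly_Mapping.keys p \<subseteq> mons (N i) \<Longrightarrow> Poly_Mapping.keys (embed i p) \<subseteq> mons n"
  using keys_push[of "incl i" p] incl_mons[of i] by (auto simp: embed_def)

lemma embed_J:
  assumes "i \<in> S" "p \<in> J i" shows "embed i p \<in> I"
proof -
  have "incl i d \<in> multiples n E" if "d \<in> multiples (N i) (F i)" for d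
  proof -
    have d: "d \<in> mons (N i)" using that by (simp add: multiples_def)
    have "proj i (incl i d) \<in> multiples (N i) (F i)" using that by (simp add: proj_incl[OF assms(1,1) d])
    then show ?thesis using multiples_iff[OF incl_mons[OF assms(1) d]] assms(1) by blast
  qed
  then show ?thesis using keys_push[of "incl i" p] assms(2) unfolding I_eq J_eq embed_def by blast
qed

definition rep :: "'k poly set \<Rightarrow> 'k poly" where
  "rep Y = (SOME p. p \<in> Y)"

lemma rep_coset: "rep (coset i p) - p \<in> J i"
proof -
  have "p \<in> coset i p" using ideal_zero[OF ideal_J poly_alg_simps(5,4)] by (simp add: coset_mem_iff)
  then have "rep (coset i p) \<in> coset i p" unfolding rep_def by (rule someI)
  then show ?thesis by (simp add: coset_mem_iff)
qed

lemma J_carrier: "p \<in> J i \<Longrightarrow> Poly_Mapping.keys p \<subseteq> mons (N i)"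
  by (auto simp: J_eq multiples_def)

lemma rep_coset_closed:
  assumes "Poly_Mapping.keys p \<subseteq> mons (N i)"
  shows "Poly_Mapping.keys (rep (coset i p)) \<subseteq> mons (N i)"
  using keys_add_subset[OF J_carrier[OF rep_coset[of i p]] assms] by simp

lemma
  assumes "u \<in> pures" "i \<in> S"
  shows rep_closed: "Poly_Mapping.keys (rep (u i)) \<subseteq> mons (N i)"
    and coset_rep: "coset i (rep (u i)) = u i"
proof -
  obtain p where p: "Poly_Mapping.keys p \<subseteq> mons (N i)" "u i = coset i p"
    using PiE_mem[OF assms] by (rule factor_cases)
  show "Poly_Mapping.keys (rep (u i)) \<subseteq> mons (N i)" unfolding p(2) by (rule rep_coset_closed[OF p(1)])
  show "coset i (rep (u i)) = u i" unfolding p(2) coset_eq by (rule rep_coset)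
qed

definition rep_prod :: "('i \<Rightarrow> 'k poly set) \<Rightarrow> 'k poly" where
  "rep_prod u = (\<Prod>i\<in>S. embed i (rep (u i)))"

lemma rep_prod_closed: "u \<in> pures \<Longrightarrow> Poly_Mapping.keys (rep_prod u) \<subseteq> mons n"
  unfolding rep_prod_def by (intro keys_prod_mons embed_closed rep_closed)

text \<open>Independence of the representatives; all properties of \<open>rep_prod\<close> follow from it by exhibiting
convenient representatives.\<close>

lemma rep_prod_cong:
  assumes "\<And>i. i \<in> S \<Longrightarrow> Poly_Mapping.keys (q i) \<subseteq> mons (N i)" "\<And>i. i \<in> S \<Longrightarrow> u i = coset i (q i)"
  shows "rep_prod u - (\<Prod>i\<in>S. embed i (q i)) \<in> I"
  unfolding rep_prod_def
proof (rule prod_cong_I[OF finite_S])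
  fix i assume i: "i \<in> S"
  show "embed i (rep (u i)) - embed i (q i) \<in> I"
    unfolding embed_diff[symmetric] assms(2)[OF i] by (rule embed_J[OF i rep_coset])
  show "Poly_Mapping.keys (embed i (rep (u i))) \<subseteq> mons n"
    unfolding assms(2)[OF i] by (rule embed_closed[OF i rep_coset_closed[OF assms(1)[OF i]]])
  show "Poly_Mapping.keys (embed i (q i)) \<subseteq> mons n" by (rule embed_closed[OF i assms(1)[OF i]])
qed

lemma rep_prod_mult:
  assumes "u \<in> pures" "v \<in> pures"
  shows "rep_prod (pure_mult S factor u v) - rep_prod u * rep_prod v \<in> I"
proof -
  have "pure_mult S factor u v i = coset i (rep (u i) * rep (v i))" if i: "i \<in> S" for i
    using coset_mult[OF rep_closed[OF assms(1) i] rep_closed[OF assms(2) i]]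
    by (simp add: pure_mult_def i coset_rep[OF assms(1) i] coset_rep[OF assms(2) i] del: quot_alg_simps)
  then have "rep_prod (pure_mult S factor u v) - (\<Prod>i\<in>S. embed i (rep (u i) * rep (v i))) \<in> I"
    by (intro rep_prod_cong keys_mult_mons rep_closed assms)
  then show ?thesis by (simp add: rep_prod_def embed_mult prod.distrib)
qed

lemma rep_prod_slot:
  assumes u: "u \<in> pures" "j \<in> S" and p: "Poly_Mapping.keys p \<subseteq> mons (N j)"
  shows "rep_prod (u(j := coset j p)) - embed j p * (\<Prod>i\<in>S - {j}. embed i (rep (u i))) \<in> I"
proof -
  \<comment> \<open>Keep the chosen representatives in the other entries.\<close>
  let ?q = "(\<lambda>i. rep (u i))(j := p)"
  have "rep_prod (u(j := coset j p)) - (\<Prod>i\<in>S. embed i (?q i)) \<in> I"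
    by (rule rep_prod_cong) (use p rep_closed[OF u(1)] coset_rep[OF u(1)] in auto)
  moreover have "(\<Prod>i\<in>S. embed i (?q i)) = embed j p * (\<Prod>i\<in>S - {j}. embed i (rep (u i)))"
    by (subst prod.remove[OF finite_S u(2)]) (auto intro!: prod.cong)
  ultimately show ?thesis by (simp only:)
qed

definition evaluate :: "(('i \<Rightarrow> 'k poly set) \<Rightarrow>\<^sub>0 'k) \<Rightarrow> 'k poly" where
  "evaluate = lin_ext (\<lambda>u c. Poly_Mapping.single 0 c * rep_prod u)"

lemma evaluate_simps [simp]:
  "evaluate 0 = 0" "evaluate (Poly_Mapping.single u c) = Poly_Mapping.single 0 c * rep_prod u"
  by (simp_all add: evaluate_def)

lemma evaluate_add: "evaluate (f + g) = evaluate f + evaluate g"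
  unfolding evaluate_def by (rule lin_ext_add) (simp_all add: single_add distrib_right)

lemma evaluate_diff: "evaluate (f - g) = evaluate f - evaluate g"
  unfolding evaluate_def by (rule lin_ext_diff) (simp_all add: single_add distrib_right)

lemma single_zero_mons: "Poly_Mapping.keys (Poly_Mapping.single 0 c) \<subseteq> mons m"
  by simp

lemma evaluate_closed:
  assumes "Poly_Mapping.keys f \<subseteq> pures" shows "Poly_Mapping.keys (evaluate f) \<subseteq> mons n"
  using assms
proof (induction f rule: poly_mapping_supp_induct)
  case (single u c)
  then show ?case by (simp only: evaluate_simps) (intro keys_mult_mons rep_prod_closed single_zero_mons)
qed (simp_all add: evaluate_add keys_add_subset)

lemma evaluate_mult:
  assumes f: "Poly_Mapping.keys f \<subseteq> pures" and g: "Poly_Mapping.keys g \<subseteq> pures"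
  shows "evaluate (f \<otimes>\<^bsub>T\<^esub> g) - evaluate f * evaluate g \<in> I"
  using f
proof (induction f rule: poly_mapping_supp_induct)
  case zero
  show ?case using I_closed(1) by simp
next
  case (single u a)
  note u = this
  from g show ?case
  proof (induction g rule: poly_mapping_supp_induct)
    case zero
    show ?case using I_closed(1) by simp
  next
    case (single v b)
    have "(rep_prod (pure_mult S factor u v) - rep_prod u * rep_prod v) * Poly_Mapping.single 0 (a * b) \<in> I"
      by (intro I_mult rep_prod_mult u single single_zero_mons)
    moreover have "Poly_Mapping.single 0 (a * b) = Poly_Mapping.single 0 a * (Poly_Mapping.single 0 b :: 'k poly)"
      by (simp add: mult_single)
    ultimately show ?case by (simp add: algebra_simps)
  next
    case (add g g')
    from I_closed(2)[OF add.IH] show ?case by (simp add: tensor_mult_add evaluate_add algebra_simps)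
  qed
next
  case (add f f')
  from I_closed(2)[OF add.IH] show ?case by (simp add: tensor_mult_add evaluate_add algebra_simps)
qed

text \<open>The product of representatives is additive and homogeneous in each entry modulo \<open>I\<close>, which is what
the defining relations of the tensor product ask for.\<close>

lemma evaluate_relation:
  assumes "f \<in> tensor_relations S factor" shows "evaluate f \<in> I"
  using assms unfolding tensor_relations_def
proof (elim UnE CollectE exE conjE)
  fix u j a b
  assume f: "f = Poly_Mapping.single (u(j := a \<oplus>\<^bsub>factor j\<^esub> b)) 1 - Poly_Mapping.single (u(j := a)) 1
      - Poly_Mapping.single (u(j := b)) 1"
    and u: "u \<in> pures" "j \<in> S" and ab: "a \<in> carrier (factor j)" "b \<in> carrier (factor j)"
  obtain p where p: "Poly_Mapping.keys p \<subseteq> mons (N j)" "a = coset j p" using ab(1) by (rule factor_cases)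
  obtain q where q: "Poly_Mapping.keys q \<subseteq> mons (N j)" "b = coset j q" using ab(2) by (rule factor_cases)
  have "evaluate f = rep_prod (u(j := coset j (p + q))) - rep_prod (u(j := coset j p)) - rep_prod (u(j := coset j q))"
    unfolding f p(2) q(2) coset_add[OF p(1) q(1)]
    by (simp add: evaluate_diff del: fun_upd_apply)
  moreover have "rep_prod (u(j := coset j (p + q))) - rep_prod (u(j := coset j p)) - rep_prod (u(j := coset j q)) \<in> I"
    using I_closed(3)[OF I_closed(3)[OF rep_prod_slot[OF u keys_add_subset[OF p(1) q(1)]]
      rep_prod_slot[OF u p(1)]] rep_prod_slot[OF u q(1)]]
    by (simp add: embed_add algebra_simps del: fun_upd_apply)
  ultimately show ?thesis by (simp only:)
next
  fix u j c a
  assume f: "f = Poly_Mapping.single (u(j := c \<odot>\<^bsub>factor j\<^esub> a)) 1 - Poly_Mapping.single (u(j := a)) c"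
    and u: "u \<in> pures" "j \<in> S" and a: "a \<in> carrier (factor j)"
  obtain p where p: "Poly_Mapping.keys p \<subseteq> mons (N j)" "a = coset j p" using a by (rule factor_cases)
  have cp: "Poly_Mapping.keys (Poly_Mapping.single 0 c * p) \<subseteq> mons (N j)"
    by (intro keys_mult_mons p single_zero_mons)
  have "evaluate f = rep_prod (u(j := coset j (Poly_Mapping.single 0 c * p)))
      - Poly_Mapping.single 0 c * rep_prod (u(j := coset j p))"
    unfolding f p(2) coset_smult[OF p(1)] by (simp add: evaluate_diff del: fun_upd_apply)
  moreover have "rep_prod (u(j := coset j (Poly_Mapping.single 0 c * p)))
      - Poly_Mapping.single 0 c * rep_prod (u(j := coset j p)) \<in> I"
    using I_closed(3)[OF rep_prod_slot[OF u cp] I_mult[OF rep_prod_slot[OF u p(1)] single_zero_mons[of c]]]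
    by (simp add: embed_mult incl_zero algebra_simps del: fun_upd_apply)
  ultimately show ?thesis by (simp only:)
qed

text \<open>The tensors with value in \<open>I\<close> form an ideal because evaluation is multiplicative modulo \<open>I\<close>, and this
ideal contains the relations.\<close>

lemma evaluate_K:
  assumes "f \<in> K" shows "evaluate f \<in> I"
proof -
  let ?L = "{f \<in> carrier T. evaluate f \<in> I}"
  have mult: "x \<otimes>\<^bsub>T\<^esub> y \<in> ?L" if xy: "x \<in> carrier T" "y \<in> carrier T" and I: "evaluate x * evaluate y \<in> I" for x y
  proof -
    have "evaluate (x \<otimes>\<^bsub>T\<^esub> y) - evaluate x * evaluate y \<in> I" using xy by (intro evaluate_mult) simp_all
    from I_closed(2)[OF this I] have "evaluate (x \<otimes>\<^bsub>T\<^esub> y) \<in> I" by simp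
    moreover have "x \<otimes>\<^bsub>T\<^esub> y \<in> carrier T" using ring.ring_simprules(5)[OF ring_T xy] .
    ultimately show ?thesis by simp
  qed
  have closed: "Poly_Mapping.keys (evaluate x) \<subseteq> mons n" if "x \<in> carrier T" for x
    using that by (intro evaluate_closed) simp
  have "ideal ?L T"
  proof (rule ideal_class_opsI[OF ring_T tensor_free_simps(4,3)])
    fix x y assume "x \<in> ?L" "y \<in> ?L"
    then show "x + y \<in> ?L" using I_closed(2) by (simp add: evaluate_add keys_add_subset)
  next
    fix x assume "x \<in> ?L"
    then show "- x \<in> ?L" using I_closed(4) evaluate_diff[of 0 x] by simp
  next
    fix a x assume ax: "a \<in> ?L" "x \<in> carrier T"
    then have "evaluate a * evaluate x \<in> I" by (intro I_mult closed) simp_all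
    moreover from this have "evaluate x * evaluate a \<in> I" by (simp only: mult.commute)
    moreover have "a \<in> carrier T" using ax(1) by blast
    ultimately show "a \<otimes>\<^bsub>T\<^esub> x \<in> ?L" "x \<otimes>\<^bsub>T\<^esub> a \<in> ?L" using mult ax(2) by blast+
  qed (use I_closed(1) in auto)
  moreover have "tensor_relations S factor \<subseteq> ?L" using relations_subset evaluate_relation by blast
  ultimately have "K \<subseteq> ?L" by (rule ring.genideal_minimal[OF ring_T])
  with assms show ?thesis by blast
qed

text \<open>For a monomial the components themselves can serve as representatives, and their product is the
monomial.\<close>

lemma evaluate_push:
  assumes "Poly_Mapping.keys p \<subseteq> mons n" shows "evaluate (push pure_of p) - p \<in> I"
  using assms
proof (induction p rule: poly_mapping_supp_induct)
  case zero
  show ?case using I_closed(1) by simp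
next
  case (single e c)
  have "rep_prod (pure_of e) - (\<Prod>i\<in>S. embed i (mon_poly (proj i e))) \<in> I"
    by (rule rep_prod_cong) (simp_all add: pure_of_def mon_poly_def proj_mons)
  moreover have "(\<Prod>i\<in>A. embed i (mon_poly (proj i e))) = mon_poly (\<Sum>i\<in>A. incl i (proj i e))" for A
    by (induction A rule: infinite_finite_induct) (simp_all add: mon_poly_def mult_single)
  ultimately have "(rep_prod (pure_of e) - mon_poly e) * Poly_Mapping.single 0 c \<in> I"
    using single by (intro I_mult single_zero_mons) (simp add: sum_incl_proj)
  then show ?case by (simp add: algebra_simps mon_poly_def mult_single)
next
  case (add f g)
  from I_closed(2)[OF add.IH] show ?case by (simp add: push_add evaluate_add algebra_simps)
qed

lemma push_in_K_iff:
  assumes "Poly_Mapping.keys p \<subseteq> mons n"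
  shows "push pure_of p \<in> K \<longleftrightarrow> p \<in> I"
proof
  assume "push pure_of p \<in> K"
  from I_closed(3)[OF evaluate_K[OF this] evaluate_push[OF assms]] show "p \<in> I" by simp
qed (rule push_I_in_K)

text \<open>The homomorphism induced by \<open>push pure_of\<close> is onto by \<open>mod_K\<close> and has kernel \<open>I\<close> by \<open>push_in_K_iff\<close>.\<close>

theorem tensor_decomposition: "alg_isomorphic (quot_alg (poly_alg n) I) (tensor_alg S factor)"
proof -
  let ?A = "poly_alg n :: ('k, 'k poly) module"
  define h where "h p = K +>\<^bsub>T\<^esub> push pure_of p" for p
  have "push pure_of \<in> ring_hom ?A T"
  proof (rule ring_hom_memI)
    show "push pure_of \<one>\<^bsub>?A\<^esub> = \<one>\<^bsub>T\<^esub>"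
      by (simp only: poly_alg_simps tensor_free_simps push_single pure_of_zero flip: single_one)
  qed (use push_pure_of_closed in \<open>simp_all add: push_pure_of_mult push_add del: quot_alg_simps\<close>)
  from ring_hom_trans[OF this ideal.rcos_ring_hom[OF ideal_K]]
  have "h \<in> ring_hom ?A (T Quot K)" by (simp add: h_def[abs_def] comp_def)
  then interpret h: ring_hom_ring ?A "T Quot K" h
    by (intro ring_hom_ringI2 ring_poly_alg ideal.quotient_is_ring[OF ideal_K])
  \<comment> \<open>The zero of the quotient is \<open>K\<close> itself; as the coset of 0 it is accessible to the coset lemma.\<close>
  have K_coset: "K = K +>\<^bsub>T\<^esub> 0" by (simp only: set_eq_iff coset_mem_iff[OF tensor_free_simps(4)] diff_zero simp_thms)
  have h_zero: "h p = K \<longleftrightarrow> push pure_of p \<in> K" for p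
    using coset_eq_iff[OF ideal_K tensor_free_simps(4,3), of "push pure_of p" 0] K_coset by (simp add: h_def)
  have "\<zero>\<^bsub>T Quot K\<^esub> = K" by (simp add: FactRing_def)
  then have "a_kernel ?A (T Quot K) h = {p. Poly_Mapping.keys p \<subseteq> mons n \<and> push pure_of p \<in> K}"
    by (simp only: a_kernel_def' h_zero poly_alg_simps mem_Collect_eq)
  then have kernel: "a_kernel ?A (T Quot K) h = I"
    using push_in_K_iff I_carrier by blast
  have surj: "h ` carrier ?A = carrier (T Quot K)"
  proof (intro equalityI subsetI)
    fix Y assume "Y \<in> carrier (T Quot K)"
    then obtain f where f: "f \<in> carrier T" "Y = K +>\<^bsub>T\<^esub> f" by (auto simp: FactRing_def A_RCOSETS_def')
    obtain p where p: "Poly_Mapping.keys p \<subseteq> mons n" "f - push pure_of p \<in> K" using mod_K[OF f(1)] by blast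
    then have "Y = h p" unfolding f(2) h_def by (simp add: coset_eq_iff[OF ideal_K])
    with p(1) show "Y \<in> h ` carrier ?A" by auto
  qed auto
  let ?H = "\<lambda>Y. the_elem (h ` Y)"
  have "?H \<in> ring_iso (quot_alg ?A I) (tensor_alg S factor)"
    using h.FactRing_iso_set[OF surj] unfolding kernel tensor_alg_def ring_iso_quot_alg .
  moreover have "?H (c \<odot>\<^bsub>quot_alg ?A I\<^esub> Y) = c \<odot>\<^bsub>tensor_alg S factor\<^esub> ?H Y"
    if Y: "Y \<in> carrier (quot_alg ?A I)" for c Y
  proof -
    obtain p where p: "Poly_Mapping.keys p \<subseteq> mons n" "Y = I +>\<^bsub>?A\<^esub> p"
      using Y by (auto simp: FactRing_def A_RCOSETS_def')
    have H: "?H (I +>\<^bsub>?A\<^esub> q) = h q" if "Poly_Mapping.keys q \<subseteq> mons n" for q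
      using h.the_elem_simp[of q] that by (simp add: kernel)
    have "c \<odot>\<^bsub>quot_alg ?A I\<^esub> Y = I +>\<^bsub>?A\<^esub> (c \<odot>\<^bsub>?A\<^esub> p)"
      unfolding p(2) by (rule quot_alg_smult[OF ideal_I, where s = "Poly_Mapping.single 0 c"]) (use p in simp_all)
    moreover have "Poly_Mapping.keys (c \<odot>\<^bsub>?A\<^esub> p) \<subseteq> mons n"
      using p(1) by (simp add: keys_mult_mons)
    ultimately have "?H (c \<odot>\<^bsub>quot_alg ?A I\<^esub> Y) = h (c \<odot>\<^bsub>?A\<^esub> p)" by (simp only: H)
    also have "\<dots> = K +>\<^bsub>T\<^esub> (c \<odot>\<^bsub>T\<^esub> push pure_of p)" by (simp only: h_def poly_alg_simps push_pure_of_smult)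
    also have "\<dots> = c \<odot>\<^bsub>tensor_alg S factor\<^esub> (K +>\<^bsub>T\<^esub> push pure_of p)"
      unfolding tensor_alg_def
    proof (rule quot_alg_smult[OF ideal_K, symmetric])
      show "Poly_Mapping.single (\<lambda>i\<in>S. \<one>\<^bsub>factor i\<^esub>) c \<in> carrier T"
        by (rule scalar_closed)
      show "c \<odot>\<^bsub>T\<^esub> f = Poly_Mapping.single (\<lambda>i\<in>S. \<one>\<^bsub>factor i\<^esub>) c \<otimes>\<^bsub>T\<^esub> f" if "f \<in> carrier T" for f
        by (rule tensor_smult_eq[OF monoid_quot_alg[OF ideal_J] that])
    qed (use push_pure_of_closed in simp_all)
    also have "\<dots> = c \<odot>\<^bsub>tensor_alg S factor\<^esub> ?H Y" unfolding p(2) H[OF p(1)] h_def ..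
    finally show ?thesis .
  qed
  ultimately show ?thesis
    unfolding alg_isomorphic_def by (intro bexI[of _ ?H] allI ballI)
qed

end

section \<open>Partitions of the variables\<close>

text \<open>The variables of each factor are numbered from \<open>1\<close>, so an enumeration \<open>\<beta>\<close> of a block of variables
intervenes: \<open>relabel\<close> writes a monomial of the factor in the original variables, and \<open>pullback\<close>
keeps the part of a monomial that lives in the block. Summing over \<open>{1..N}\<close> instead of the support
makes both visibly additive.\<close>

definition relabel :: "(nat \<Rightarrow> nat) \<Rightarrow> nat \<Rightarrow> mon \<Rightarrow> mon" where
  "relabel \<beta> N d = (\<Sum>k\<in>{1..N}. Poly_Mapping.single (\<beta> k) (Poly_Mapping.lookup d k))"

definition pullback :: "(nat \<Rightarrow> nat) \<Rightarrow> nat \<Rightarrow> mon \<Rightarrow> mon" where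
  "pullback \<beta> N e = (\<Sum>k\<in>{1..N}. Poly_Mapping.single k (Poly_Mapping.lookup e (\<beta> k)))"

lemma lookup_pullback:
  "Poly_Mapping.lookup (pullback \<beta> N e) k = (if k \<in> {1..N} then Poly_Mapping.lookup e (\<beta> k) else 0)"
  by (simp add: pullback_def lookup_sum lookup_single when_def)

lemma lookup_relabel:
  assumes "inj_on \<beta> {1..N}" "k \<in> {1..N}"
  shows "Poly_Mapping.lookup (relabel \<beta> N d) (\<beta> k) = Poly_Mapping.lookup d k"
proof -
  have "Poly_Mapping.lookup (relabel \<beta> N d) (\<beta> k) = (\<Sum>l\<in>{1..N}. if l = k then Poly_Mapping.lookup d l else 0)"
    unfolding relabel_def lookup_sum lookup_single when_def
    by (rule sum.cong[OF refl]) (use assms in \<open>auto dest: inj_onD\<close>)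
  then show ?thesis using assms(2) by simp
qed

lemma lookup_relabel_outside:
  assumes "v \<notin> \<beta> ` {1..N}"
  shows "Poly_Mapping.lookup (relabel \<beta> N d) v = 0"
  unfolding relabel_def lookup_sum lookup_single when_def using assms by (intro sum.neutral) auto

lemma pullback_mons: "pullback \<beta> N e \<in> mons N"
  by (auto simp: mons_def in_keys_iff lookup_pullback split: if_splits)

lemma lookup_mons_outside: "e \<in> mons n \<Longrightarrow> v \<notin> {1..n} \<Longrightarrow> Poly_Mapping.lookup e v = 0"
  by (auto simp: mons_def in_keys_iff subset_iff)

lemma relabel_pullback:
  assumes "bij_betw \<beta> {1..N} B" "Poly_Mapping.keys e \<subseteq> B"
  shows "relabel \<beta> N (pullback \<beta> N e) = e"
proof (rule poly_mapping_eqI)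
  fix v
  show "Poly_Mapping.lookup (relabel \<beta> N (pullback \<beta> N e)) v = Poly_Mapping.lookup e v"
  proof (cases "v \<in> B")
    case True
    then obtain k where "k \<in> {1..N}" "v = \<beta> k" using assms(1) by (auto simp: bij_betw_def)
    then show ?thesis using assms(1) by (simp add: lookup_relabel lookup_pullback bij_betw_def)
  next
    case False
    then have "v \<notin> Poly_Mapping.keys e" using assms(2) by blast
    moreover have "v \<notin> \<beta> ` {1..N}" using False assms(1) by (simp add: bij_betw_def)
    ultimately show ?thesis by (simp add: lookup_relabel_outside in_keys_iff)
  qed
qed

text \<open>The blocks \<open>g v = i\<close> split every monomial into components. A generator whose variables all lie in
one block divides a monomial iff it divides the component in that block, which is the condition on
the ideals in \<open>monomial_splitting\<close>.\<close>

theorem monomial_ring_splits: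
  fixes S :: "'i set" and g :: "nat \<Rightarrow> 'i" and \<beta> :: "'i \<Rightarrow> nat \<Rightarrow> nat" and E :: "mon set"
  assumes S: "finite S" "g ` {1..n} \<subseteq> S"
    and \<beta>: "\<And>i. i \<in> S \<Longrightarrow> bij_betw (\<beta> i) {1..N i} {v \<in> {1..n}. g v = i}"
    and E: "E \<subseteq> mons n" "\<And>e. e \<in> E \<Longrightarrow> \<exists>i\<in>S. Poly_Mapping.keys e \<subseteq> {v. g v = i}"
  defines "F \<equiv> \<lambda>i. pullback (\<beta> i) (N i) ` {e \<in> E. Poly_Mapping.keys e \<subseteq> {v. g v = i}}"
  shows "alg_isomorphic
    (monomial_ring n (Idl\<^bsub>poly_alg n\<^esub> ((mon_poly :: mon \<Rightarrow> 'k::field poly) ` E)))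
    (tensor_alg S (\<lambda>i. monomial_ring (N i) (Idl\<^bsub>poly_alg (N i)\<^esub> (mon_poly ` F i))))"
proof -
  let ?incl = "\<lambda>i. relabel (\<beta> i) (N i)" and ?proj = "\<lambda>i. pullback (\<beta> i) (N i)"
  let ?I = "Idl\<^bsub>poly_alg n\<^esub> ((mon_poly :: mon \<Rightarrow> 'k poly) ` E)"
    and ?J = "\<lambda>i. Idl\<^bsub>poly_alg (N i)\<^esub> ((mon_poly :: mon \<Rightarrow> 'k poly) ` F i)"
  have inj: "inj_on (\<beta> i) {1..N i}" and img: "\<beta> i ` {1..N i} = {v \<in> {1..n}. g v = i}" if "i \<in> S" for i
    using \<beta>[OF that] by (simp_all add: bij_betw_def)
  have proj_add: "?proj i (a + b) = ?proj i a + ?proj i b" for i a b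
    by (simp add: pullback_def lookup_add single_add sum.distrib)
  have incl_add: "?incl i (a + b) = ?incl i a + ?incl i b" for i a b
    by (simp add: relabel_def lookup_add single_add sum.distrib)
  have sum_incl_proj: "(\<Sum>i\<in>S. ?incl i (?proj i e)) = e" if e: "e \<in> mons n" for e
  proof (rule poly_mapping_eqI)
    fix v
    have "Poly_Mapping.lookup (?incl i (?proj i e)) v = (if i = g v then Poly_Mapping.lookup e v else 0)"
      if i: "i \<in> S" for i
    proof (cases "v \<in> \<beta> i ` {1..N i}")
      case True
      then obtain k where "k \<in> {1..N i}" "v = \<beta> i k" by blast
      moreover have "g v = i" using True img[OF i] by auto
      ultimately show ?thesis by (simp add: lookup_relabel[OF inj[OF i]] lookup_pullback)
    next
      case False
      then have "g v = i \<Longrightarrow> v \<notin> {1..n}" unfolding img[OF i] by blast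
      then have "g v = i \<Longrightarrow> Poly_Mapping.lookup e v = 0" using lookup_mons_outside[OF e] by blast
      then show ?thesis by (auto simp: lookup_relabel_outside[OF False])
    qed
    then have "Poly_Mapping.lookup (\<Sum>i\<in>S. ?incl i (?proj i e)) v = (\<Sum>i\<in>S. if i = g v then Poly_Mapping.lookup e v else 0)"
      unfolding lookup_sum by (rule sum.cong[OF refl])
    also have "\<dots> = Poly_Mapping.lookup e v"
      using S lookup_mons_outside[OF e, of v] by (auto simp: image_subset_iff)
    finally show "Poly_Mapping.lookup (\<Sum>i\<in>S. ?incl i (?proj i e)) v = Poly_Mapping.lookup e v" .
  qed
  interpret monomial_splitting S n N ?incl ?proj E F ?I ?J
  proof
    fix i j d assume i: "i \<in> S" and j: "j \<in> S" and d: "d \<in> mons (N i)"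
    show "?proj j (?incl i d) = (if j = i then d else 0)"
    proof (rule poly_mapping_eqI)
      fix k
      show "Poly_Mapping.lookup (?proj j (?incl i d)) k = Poly_Mapping.lookup (if j = i then d else 0) k"
      proof (cases "k \<in> {1..N j}")
        case False
        then show ?thesis
          using lookup_mons_outside[OF d, of k]
          by (cases "j = i") (simp_all add: lookup_pullback del: atLeastAtMost_iff)
      next
        case k: True
        then have "g (\<beta> j k) = j" using imageI[OF k, of "\<beta> j"] unfolding img[OF j] by simp
        then have "\<beta> j k \<notin> \<beta> i ` {1..N i}" if "j \<noteq> i" using that unfolding img[OF i] by simp
        with k show ?thesis
          by (cases "j = i") (simp_all add: lookup_pullback lookup_relabel[OF inj[OF i]] lookup_relabel_outside)
      qed
    qed
  next
    fix i d assume i: "i \<in> S"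
    have "v \<in> {1..n}" if "Poly_Mapping.lookup (?incl i d) v \<noteq> 0" for v
    proof -
      have "v \<in> \<beta> i ` {1..N i}" using that lookup_relabel_outside[of v "\<beta> i" "N i" d] by argo
      then show ?thesis unfolding img[OF i] by simp
    qed
    then show "?incl i d \<in> mons n" by (auto simp: mons_def in_keys_iff)
  next
    fix e assume e: "e \<in> mons n"
    show "e \<in> multiples n E \<longleftrightarrow> (\<exists>i\<in>S. ?proj i e \<in> multiples (N i) (F i))"
    proof
      assume "e \<in> multiples n E"
      then obtain d a where d: "d \<in> E" "e = d + a" by (auto simp: multiples_def)
      then obtain i where i: "i \<in> S" "Poly_Mapping.keys d \<subseteq> {v. g v = i}" using E(2) by blast
      then have "?proj i d \<in> F i" using d(1) by (auto simp: F_def)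
      moreover have "?proj i e = ?proj i d + ?proj i a" unfolding d(2) by (rule proj_add)
      ultimately show "\<exists>i\<in>S. ?proj i e \<in> multiples (N i) (F i)"
        using i(1) pullback_mons unfolding multiples_def by blast
    next
      assume "\<exists>i\<in>S. ?proj i e \<in> multiples (N i) (F i)"
      then obtain i d a where i: "i \<in> S" and d: "d \<in> E" "Poly_Mapping.keys d \<subseteq> {v. g v = i}"
        and a: "?proj i e = ?proj i d + a"
        unfolding multiples_def F_def by blast
      have "Poly_Mapping.keys d \<subseteq> {v \<in> {1..n}. g v = i}" using d E(1) unfolding mons_def by blast
      then have d_eq: "?incl i (?proj i d) = d" by (rule relabel_pullback[OF \<beta>[OF i]])
      have "e = ?incl i (?proj i e) + (\<Sum>j\<in>S - {i}. ?incl j (?proj j e))"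
        using sum_incl_proj[OF e] sum.remove[OF S(1) i] by metis
      also have "\<dots> = d + (?incl i a + (\<Sum>j\<in>S - {i}. ?incl j (?proj j e)))"
        unfolding a incl_add d_eq by (rule add.assoc)
      finally show "e \<in> multiples n E" using e d(1) unfolding multiples_def by blast
    qed
  next
    have "F i \<subseteq> mons (N i)" for i using pullback_mons by (auto simp: F_def)
    then show "?J i = {p. Poly_Mapping.keys p \<subseteq> multiples (N i) (F i)}" for i by (rule Idl_monomials)
  qed (use S proj_add incl_add pullback_mons sum_incl_proj Idl_monomials[OF E(1)] in \<open>simp_all add: relabel_def\<close>)
  show ?thesis by (rule tensor_decomposition)
qed

section \<open>Minimality of the Taylor resolution\<close>

lemma lookup_mon_lcm:
  assumes "finite S"
  shows "Poly_Mapping.lookup (mon_lcm m S) v = Max (insert 0 ((\<lambda>i. Poly_Mapping.lookup (m i) v) ` S))"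
proof -
  let ?f = "\<lambda>v. Max (insert 0 ((\<lambda>i. Poly_Mapping.lookup (m i) v) ` S))"
  have "\<exists>i\<in>S. v \<in> Poly_Mapping.keys (m i)" if "?f v \<noteq> 0" for v
  proof (rule ccontr)
    assume "\<not> ?thesis"
    then have "insert 0 ((\<lambda>i. Poly_Mapping.lookup (m i) v) ` S) = {0}" by (auto simp: in_keys_iff)
    with that show False by simp
  qed
  then have "{v. ?f v \<noteq> 0} \<subseteq> (\<Union>i\<in>S. Poly_Mapping.keys (m i))" by blast
  then have "finite {v. ?f v \<noteq> 0}" by (rule finite_subset) (use assms in simp)
  then show ?thesis unfolding mon_lcm_def by simp
qed

text \<open>If omitting \<open>m i\<close> changes the least common multiple, the change is visible at some variable, and there
\<open>m i\<close> alone attains the maximal exponent.\<close>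

lemma mon_lcm_remove_neq:
  assumes "finite S" "i \<in> S" "mon_lcm m S \<noteq> mon_lcm m (S - {i})"
  shows "\<exists>v. Poly_Mapping.lookup (m i) v > 0 \<and>
    (\<forall>j\<in>S - {i}. Poly_Mapping.lookup (m j) v < Poly_Mapping.lookup (m i) v)"
proof -
  obtain v where v: "Poly_Mapping.lookup (mon_lcm m S) v \<noteq> Poly_Mapping.lookup (mon_lcm m (S - {i})) v"
    using assms(3) poly_mapping_eqI[of "mon_lcm m S" "mon_lcm m (S - {i})"] by metis
  let ?M = "insert 0 ((\<lambda>j. Poly_Mapping.lookup (m j) v) ` (S - {i}))"
  have "insert 0 ((\<lambda>j. Poly_Mapping.lookup (m j) v) ` S) = insert (Poly_Mapping.lookup (m i) v) ?M"
    using assms(2) by blast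
  then have "Poly_Mapping.lookup (mon_lcm m S) v = max (Poly_Mapping.lookup (m i) v) (Max ?M)"
    using assms(1) by (simp add: lookup_mon_lcm del: insert_iff)
  moreover have "Poly_Mapping.lookup (mon_lcm m (S - {i})) v = Max ?M"
    by (rule lookup_mon_lcm) (use assms(1) in simp)
  ultimately have "max (Poly_Mapping.lookup (m i) v) (Max ?M) \<noteq> Max ?M" using v by metis
  then have "Max ?M < Poly_Mapping.lookup (m i) v" by (metis max.absorb2 not_less)
  moreover have "finite ?M" using assms(1) by simp
  ultimately have "x < Poly_Mapping.lookup (m i) v" if "x \<in> ?M" for x
    using Max_ge[of ?M x] that by (metis le_less_trans)
  then show ?thesis by (intro exI[of _ v] conjI ballI) simp_all
qed

text \<open>The differential of the top basis element has, at the face without \<open>i\<close>, the coefficient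
\<open>\<plusminus> lcm(all) / lcm(all but i)\<close>. If the two agree, this is a unit, which is not in the maximal ideal.\<close>

lemma taylor_minimal_lcm:
  assumes "taylor_minimal TYPE('k::field) n t m" "i \<in> {1..t}"
  shows "mon_lcm m {1..t} \<noteq> mon_lcm m ({1..t} - {i})"
proof
  let ?S = "{1..t}"
  assume eq: "mon_lcm m ?S = mon_lcm m (?S - {i})"
  let ?f = "Poly_Mapping.single ?S (1 :: 'k poly)"
  let ?X = "\<lambda>j. (-1) ^ card {l\<in>?S. l < j} * mon_poly (mon_lcm m ?S - mon_lcm m (?S - {j})) :: 'k poly"
  let ?V = "(\<lambda>v. Poly_Mapping.single v 1) ` {1..n} :: mon set"
  have "?f \<in> taylor_module n t" by (auto simp: taylor_module_def lookup_single when_def)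
  then have "Poly_Mapping.lookup (taylor_diff m ?f) (?S - {i}) \<in> Idl\<^bsub>poly_alg n\<^esub> (mon_poly ` ?V)"
    using assms(1) unfolding taylor_minimal_def image_image by blast
  moreover have "Poly_Mapping.lookup (taylor_diff m ?f) (?S - {i}) = ?X i"
  proof -
    have "Poly_Mapping.lookup (taylor_diff m ?f) (?S - {i}) = (\<Sum>j\<in>?S. ?X j when ?S - {j} = ?S - {i})"
      by (simp add: taylor_diff_def lookup_sum lookup_single)
    also have "\<dots> = (\<Sum>j\<in>?S. if j = i then ?X j else 0)"
    proof (rule sum.cong[OF refl])
      fix j assume "j \<in> ?S"
      then have "?S - {j} = ?S - {i} \<longleftrightarrow> j = i" using assms(2) by blast
      then show "(?X j when ?S - {j} = ?S - {i}) = (if j = i then ?X j else 0)" by (simp add: when_def)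
    qed
    also have "\<dots> = ?X i" using assms(2) by simp
    finally show ?thesis .
  qed
  ultimately have "?X i \<in> {p. Poly_Mapping.keys p \<subseteq> multiples n ?V}"
    by (subst (asm) Idl_monomials) (auto simp: mons_def)
  moreover have "0 \<in> Poly_Mapping.keys (?X i)"
  proof -
    have "?X i = (-1) ^ card {l\<in>?S. l < i}" unfolding eq by (simp add: mon_poly_def)
    then show ?thesis by (cases "even (card {l\<in>?S. l < i})") simp_all
  qed
  ultimately have "0 \<in> multiples n ?V" by blast
  then obtain v :: nat and a where "0 = Poly_Mapping.single v (1::nat) + a" unfolding multiples_def by blast
  then have "a + Poly_Mapping.single v (1::nat) = 0" by (simp add: add.commute)
  then have "Poly_Mapping.single v (1::nat) = 0" by (rule mon_add_eq_zero)
  then show False by (metis lookup_single_eq lookup_zero one_neq_zero)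
qed

section \<open>Quadratic monomials\<close>

lemma mon_deg_add: "mon_deg (a + b) = mon_deg a + mon_deg b"
  using lin_ext_add[of "\<lambda>v c. c" a b] by (simp add: mon_deg_def lin_ext_def)

lemma mon_deg_single: "mon_deg (Poly_Mapping.single v c) = c"
  by (simp add: mon_deg_def)

lemma mon_deg_eq_0: "mon_deg e = 0 \<Longrightarrow> e = 0"
  by (rule poly_mapping_eqI) (auto simp: mon_deg_def in_keys_iff)

lemma extract_variable:
  assumes "Poly_Mapping.lookup (e::mon) v > 0"
  obtains a where "e = Poly_Mapping.single v 1 + a"
proof
  show "e = Poly_Mapping.single v 1 + (e - Poly_Mapping.single v 1)"
    by (rule poly_mapping_eqI) (use assms in \<open>auto simp: lookup_add lookup_minus lookup_single when_def\<close>)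
qed

text \<open>The case \<open>w = v\<close> is that of a square.\<close>

lemma quadratic_mon:
  assumes "mon_deg e = 2" "Poly_Mapping.lookup e v > 0"
  shows "\<exists>w. e = Poly_Mapping.single v 1 + Poly_Mapping.single w 1"
proof -
  obtain a where a: "e = Poly_Mapping.single v 1 + a" using assms(2) by (rule extract_variable)
  then have "mon_deg a = 1" using assms(1) by (simp add: mon_deg_add mon_deg_single)
  then obtain w where "Poly_Mapping.lookup a w > 0" unfolding mon_deg_def by (metis gr0I not_one_le_zero sum.neutral order_refl)
  then obtain b where b: "a = Poly_Mapping.single w 1 + b" by (rule extract_variable)
  then have "mon_deg b = 0" using \<open>mon_deg a = 1\<close> by (simp add: mon_deg_add mon_deg_single)
  then have "b = 0" by (rule mon_deg_eq_0)
  then show ?thesis using a b by auto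
qed

section \<open>The factors\<close>

text \<open>The zero ideal is generated by the empty sequence, so a polynomial ring qualifies.\<close>

lemma complete_intersection_zero_ideal:
  "complete_intersection n (Idl\<^bsub>poly_alg n\<^esub> ({} :: 'k::field poly set))"
proof -
  have "Idl\<^bsub>poly_alg n\<^esub> ({} :: 'k poly set) = {p. Poly_Mapping.keys p \<subseteq> multiples n {}}"
    using Idl_monomials[of "{}" n, where 'k = 'k] by simp
  moreover have "(1 :: 'k poly) \<notin> {p. Poly_Mapping.keys p \<subseteq> multiples n {}}" by (simp add: multiples_def)
  moreover have "(1 :: 'k poly) \<in> carrier (poly_alg n)" by simp
  ultimately have "Idl\<^bsub>poly_alg n\<^esub> ({} :: 'k poly set) \<noteq> carrier (poly_alg n)" by metis
  then show ?thesis
    unfolding complete_intersection_def regular_sequence_def by (intro exI[of _ "[]"]) simp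
qed

text \<open>Passing to the minimal generators only shrinks the set that has to be divided by the common variable.\<close>

lemma trivially_golod_common_variable:
  assumes F: "F \<subseteq> mons n" and k: "k \<in> {1..n}" "\<And>e. e \<in> F \<Longrightarrow> Poly_Mapping.lookup e k > 0"
  shows "trivially_golod n (Idl\<^bsub>poly_alg n\<^esub> ((mon_poly :: mon \<Rightarrow> 'k::field poly) ` F))"
proof -
  let ?d = "Poly_Mapping.single k 1 :: mon"
  have "(mon_poly ?d :: 'k poly) divides\<^bsub>poly_alg n\<^esub> mon_poly e" if e: "e \<in> F" for e
  proof -
    obtain a where a: "e = ?d + a" using k(2)[OF e] by (rule extract_variable)
    then have "a \<in> mons n" using e F mons_addD by blast
    then have "(mon_poly a :: 'k poly) \<in> carrier (poly_alg n)" by (simp add: mon_poly_def)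
    moreover have "(mon_poly e :: 'k poly) = mon_poly ?d \<otimes>\<^bsub>poly_alg n\<^esub> mon_poly a"
      by (simp add: a mon_poly_def mult_single)
    ultimately show ?thesis by (rule dividesI)
  qed
  moreover have "min_gens n (Idl\<^bsub>poly_alg n\<^esub> ((mon_poly :: mon \<Rightarrow> 'k poly) ` F)) \<subseteq> F"
    unfolding min_gens_Idl[OF F] by (auto simp: indivisible_def)
  moreover have "(mon_poly ?d :: 'k poly) \<noteq> 1"
  proof
    assume "(mon_poly ?d :: 'k poly) = 1"
    then have "Poly_Mapping.keys (mon_poly ?d :: 'k poly) = Poly_Mapping.keys (1 :: 'k poly)" by simp
    then have "?d = 0" by (simp add: mon_poly_def)
    then show False by (metis lookup_single_eq lookup_zero one_neq_zero)
  qed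
  moreover have "?d \<in> mons n" using k(1) by (simp add: mons_def)
  ultimately show ?thesis unfolding trivially_golod_def by blast
qed

lemma monomial_ideal_min_gens:
  assumes "monomial_ideal n (I :: 'k::field poly set)"
  shows "min_gens n I \<subseteq> mons n" "I = Idl\<^bsub>poly_alg n\<^esub> (mon_poly ` min_gens n I)"
proof -
  obtain E where E: "E \<subseteq> mons n" "I = Idl\<^bsub>poly_alg n\<^esub> (mon_poly ` E)"
    using assms by (auto simp: monomial_ideal_def)
  have G: "min_gens n I = indivisible E" unfolding E(2) by (rule min_gens_Idl[OF E(1)])
  show sub: "min_gens n I \<subseteq> mons n" unfolding G using E(1) by (auto simp: indivisible_def)
  show "I = Idl\<^bsub>poly_alg n\<^esub> (mon_poly ` min_gens n I)"
    using E Idl_monomials_eq_iff[of "indivisible E" n E, where 'k = 'k] sub multiples_indivisible[OF E(1)]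
    unfolding G by simp
qed

section \<open>Grouping quadratic generators by their centers\<close>

theorem theorem4p2:
  fixes n t :: nat and I :: "'k::field poly set" and m :: "nat \<Rightarrow> mon"
  assumes "monomial_ideal n I"
    and "bij_betw m {1..t} (min_gens n I)"
    and "taylor_minimal TYPE('k) n t m"
    and "\<forall>e\<in>min_gens n I. mon_deg e = 2"
  shows "\<exists>(s::nat) (N :: nat \<Rightarrow> nat) (J :: nat \<Rightarrow> 'k poly set).
    (\<forall>i\<in>{0..s}. monomial_ideal (N i) (J i)) \<and>
    complete_intersection (N 0) (J 0) \<and>
    (\<forall>i\<in>{1..s}. trivially_golod (N i) (J i)) \<and>
    alg_isomorphic (monomial_ring n I) (tensor_alg {0..s} (\<lambda>i. monomial_ring (N i) (J i)))"
proof -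
  let ?T = "{1..t}" and ?G = "min_gens n I"
  note G = monomial_ideal_min_gens[OF assms(1)]
  have m_G: "m ` ?T = ?G" using assms(2) by (simp add: bij_betw_def)
  have "\<exists>v w. m i = Poly_Mapping.single v 1 + Poly_Mapping.single w 1 \<and>
      (\<forall>j\<in>?T - {i}. Poly_Mapping.lookup (m j) v < Poly_Mapping.lookup (m i) v)" if i: "i \<in> ?T" for i
  proof -
    obtain v where v: "Poly_Mapping.lookup (m i) v > 0"
      "\<forall>j\<in>?T - {i}. Poly_Mapping.lookup (m j) v < Poly_Mapping.lookup (m i) v"
      using mon_lcm_remove_neq[OF _ i taylor_minimal_lcm[OF assms(3) i]] by auto
    have "mon_deg (m i) = 2" using assms(4) m_G i by blast
    with v quadratic_mon show ?thesis by blast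
  qed
  then have "\<forall>i\<in>?T. \<exists>v w. m i = Poly_Mapping.single v 1 + Poly_Mapping.single w 1 \<and>
      (\<forall>j\<in>?T - {i}. Poly_Mapping.lookup (m j) v < Poly_Mapping.lookup (m i) v)" by blast
  from bchoice[OF this] obtain v where "\<forall>i\<in>?T. \<exists>w. m i = Poly_Mapping.single (v i) 1 + Poly_Mapping.single w 1 \<and>
      (\<forall>j\<in>?T - {i}. Poly_Mapping.lookup (m j) (v i) < Poly_Mapping.lookup (m i) (v i))" by blast
  from bchoice[OF this] obtain w where
    m_eq: "\<And>i. i \<in> ?T \<Longrightarrow> m i = Poly_Mapping.single (v i) 1 + Poly_Mapping.single (w i) 1" and
    priv: "\<And>i j. i \<in> ?T \<Longrightarrow> j \<in> ?T \<Longrightarrow> j \<noteq> i \<Longrightarrow>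
      Poly_Mapping.lookup (m j) (v i) < Poly_Mapping.lookup (m i) (v i)"
    by blast
  have lookup_m: "Poly_Mapping.lookup (m i) x = (if x = v i then 1 else 0) + (if x = w i then 1 else 0)"
    if "i \<in> ?T" for i x
    by (auto simp: m_eq[OF that] lookup_add lookup_single when_def)
  \<comment> \<open>Each of two generators with the same private variable would have the larger exponent there.\<close>
  have v_inj: "i = j" if "i \<in> ?T" "j \<in> ?T" "v i = v j" for i j
    using priv[OF that(1,2)] priv[OF that(2,1)] that(3) by fastforce
  \<comment> \<open>If the private variable of one generator is the center of another, the former has it with exponent at least 2 and is its square.\<close>
  have v_center: "w j = w i" if "i \<in> ?T" "j \<in> ?T" "v i = w j" for i j
  proof (cases "j = i")
    case False
    from priv[OF that(1,2) False] that(3) have "w i = v i"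
      unfolding lookup_m[OF that(1)] lookup_m[OF that(2)] by (simp split: if_splits)
    with that(3) show ?thesis by simp
  qed simp
  let ?C = "w ` ?T"
  obtain c where c: "bij_betw c {1..card ?C} ?C"
    using ex_bij_betw_nat_finite_1[of ?C] by auto
  define s where "s = card ?C"
  define idx where "idx = inv_into {1..s} c"
  have idx: "bij_betw idx ?C {1..s}" unfolding idx_def s_def by (rule bij_betw_inv_into[OF c])
  \<comment> \<open>Variables are labelled by the number of their center; label 0 collects the variables that occur in no generator.\<close>
  define g where "g x = (if x \<in> ?C then idx x
    else if x \<in> v ` ?T then idx (w (inv_into ?T v x)) else 0)" for x
  have g_w: "g (w j) = idx (w j)" if "j \<in> ?T" for j
    using that by (simp add: g_def)
  \<comment> \<open>A private variable that is itself a center gets the same label by either clause.\<close>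
  have g_v: "g (v j) = idx (w j)" if j: "j \<in> ?T" for j
  proof (cases "v j \<in> ?C")
    case True
    then obtain i where i: "i \<in> ?T" "v j = w i" by blast
    show ?thesis using v_center[OF j i] g_w[OF i(1)] i(2) by simp
  next
    case False
    have "inv_into ?T v (v j) = j" using v_inj j by (intro inv_into_f_f) (auto simp: inj_on_def)
    then show ?thesis using False j by (simp add: g_def)
  qed
  have keys_m: "Poly_Mapping.keys (m j) = {v j, w j}" if "j \<in> ?T" for j
    by (auto simp: in_keys_iff lookup_m[OF that] split: if_splits)
  have idx_range: "idx (w j) \<in> {1..s}" if "j \<in> ?T" for j
    using bij_betwE[OF idx] that by blast
  have "g x \<in> {0..s}" for x
  proof -
    have "inv_into ?T v x \<in> ?T" if "x \<in> v ` ?T" using inv_into_into[OF that] .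
    then show ?thesis using idx_range by (auto simp: g_def)
  qed
  then have g_range: "g ` {1..n} \<subseteq> {0..s}" by blast
  define N where "N i = card {x \<in> {1..n}. g x = i}" for i
  have "\<forall>i. \<exists>b. bij_betw b {1..N i} {x \<in> {1..n}. g x = i}"
    unfolding N_def by (intro allI ex_bij_betw_nat_finite_1) simp
  then obtain \<beta> where \<beta>: "\<And>i. bij_betw (\<beta> i) {1..N i} {x \<in> {1..n}. g x = i}" by metis
  define F where "F i = pullback (\<beta> i) (N i) ` {e \<in> ?G. Poly_Mapping.keys e \<subseteq> {x. g x = i}}" for i
  define J where "J i = Idl\<^bsub>poly_alg (N i)\<^esub> ((mon_poly :: mon \<Rightarrow> 'k poly) ` F i)" for i
  have F_mons: "F i \<subseteq> mons (N i)" for i using pullback_mons by (auto simp: F_def)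
  have F_cases: "\<exists>j\<in>?T. e = pullback (\<beta> i) (N i) (m j) \<and> idx (w j) = i" if e: "e \<in> F i" for e i
  proof -
    from e obtain j where j: "j \<in> ?T" "Poly_Mapping.keys (m j) \<subseteq> {x. g x = i}" "e = pullback (\<beta> i) (N i) (m j)"
      unfolding F_def m_G[symmetric] by blast
    then have "g (w j) = i" unfolding keys_m[OF j(1)] by blast
    with g_w[OF j(1)] j show ?thesis by metis
  qed
  have ideal: "monomial_ideal (N i) (J i)" for i
    unfolding monomial_ideal_def J_def using F_mons by blast
  have ci: "complete_intersection (N 0) (J 0)"
  proof -
    \<comment> \<open>Block 0 contains no generator, so its ring is a polynomial ring.\<close>
    have "False" if "e \<in> F 0" for e
      using F_cases[OF that] idx_range by force
    then have "F 0 = {}" by blast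
    then show ?thesis unfolding J_def by (simp add: complete_intersection_zero_ideal)
  qed
  have golod: "trivially_golod (N i) (J i)" if i: "i \<in> {1..s}" for i
  proof -
    have "i \<in> idx ` ?C" using i by (simp only: bij_betw_imp_surj_on[OF idx])
    then obtain j where j: "j \<in> ?T" "idx (w j) = i" by blast
    \<comment> \<open>The common factor is the variable of the center; \<open>k\<close> will be its number within the block.\<close>
    have "w j \<in> Poly_Mapping.keys (m j)" using keys_m[OF j(1)] by blast
    moreover have "m j \<in> mons n" using G(1) m_G j(1) by blast
    ultimately have "w j \<in> {x \<in> {1..n}. g x = i}" using j(2) g_w[OF j(1)] unfolding mons_def by blast
    then have "w j \<in> \<beta> i ` {1..N i}" by (simp only: bij_betw_imp_surj_on[OF \<beta>[of i]])
    then obtain k where k: "k \<in> {1..N i}" "\<beta> i k = w j" by (metis imageE)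
    have pos: "Poly_Mapping.lookup e k > 0" if e: "e \<in> F i" for e
    proof -
      obtain j' where j': "j' \<in> ?T" "e = pullback (\<beta> i) (N i) (m j')" "idx (w j') = i"
        using F_cases[OF e] by blast
      have "idx (w j') = idx (w j)" by (simp only: j(2) j'(3))
      then have "w j' = w j"
        by (rule inj_onD[OF bij_betw_imp_inj_on[OF idx]]) (rule imageI[OF j'(1)], rule imageI[OF j(1)])
      then show ?thesis using k by (simp add: j'(2) lookup_pullback lookup_m[OF j'(1)])
    qed
    show ?thesis unfolding J_def by (rule trivially_golod_common_variable[OF F_mons k(1) pos])
  qed
  have iso: "alg_isomorphic (monomial_ring n I) (tensor_alg {0..s} (\<lambda>i. monomial_ring (N i) (J i)))"
  proof -
    have "\<exists>i\<in>{0..s}. Poly_Mapping.keys e \<subseteq> {x. g x = i}" if e: "e \<in> ?G" for e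
    proof -
      obtain j where j: "j \<in> ?T" "e = m j" using m_G e by blast
      then show ?thesis using keys_m[OF j(1)] g_w[OF j(1)] g_v[OF j(1)] idx_range[OF j(1)]
        by (intro bexI[of _ "idx (w j)"]) auto
    qed
    from monomial_ring_splits[OF _ g_range \<beta> G(1) this, where 'k = 'k]
    show ?thesis unfolding G(2)[symmetric] by (simp only: F_def J_def finite_atLeastAtMost)
  qed
  show ?thesis
    by (intro exI[of _ s] exI[of _ N] exI[of _ J] conjI ballI ideal ci golod iso)
qed

end
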